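(* Let $d, m \geq 1$ be integers, let $\lambda = (\lambda_1, \dots, \lambda_m)$ be a weight, let $-\infty \leq p \leq 1/d$, and let $\beta = (\beta_1, \dots, \beta_m) \in (\mathbb{R} \setminus \{0\})^m$. Let $f_1, \dots, f_m, g_1, \dots, g_m \colon \mathbb{R}^d \to \mathbb{R}_{\geq 0}$ be integrable functions with $0 < \| f_i \|_1 < \infty$ for every $i = 1, \dots, m$. Put $S = S(f_1) \times \dots \times S(f_m)$ and $$K_\beta = \operatorname*{ess\,inf}_{x = (x_1, \dots, x_m) \in S} M_p^\lambda \left( \frac{g_1(z_\beta(x))}{f_1(x_1)}, \dots, \frac{g_m(z_\beta(x))}{f_m(x_m)} \right),$$ the essential infimum being with respect to Lebesgue measure on $S$. Then $$K_\beta \leq M_{Q_d(p)}^\lambda \left( \left( \frac{\lambda_1}{|\beta_1|} \right)^d \frac{\| g_1 \|_1}{\| f_1 \|_1}, \dots, \left( \frac{\lambda_m}{|\beta_m|} \right)^d \frac{\| g_m \|_1}{\| f_m \|_1} \right).$$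
   Context: A weight is a tuple $\lambda = (\lambda_1, \dots, \lambda_m)$ of positive real numbers with $\sum_{i=1}^m \lambda_i = 1$. For a weight $\lambda$ and $-\infty \leq p \leq \infty$, the weighted power mean $M_p^\lambda \colon \mathbb{R}_{\geq 0}^m \to \mathbb{R}_{\geq 0}$ is defined by: $M_0^\lambda(a) = \prod_{i=1}^m a_i^{\lambda_i}$; $M_{-\infty}^\lambda(a) = \min_i a_i$; $M_\infty^\lambda(a) = \max_i a_i$; $M_p^\lambda(a) = 0$ if $-\infty \leq p \leq 0$ and $\prod_{i=1}^m a_i = 0$; and $M_p^\lambda(a) = \left( \sum_{i=1}^m \lambda_i a_i^p \right)^{1/p}$ otherwise. For $x = (x_1, \dots, x_m) \in (\mathbb{R}^d)^m$, $z_\beta(x) = \sum_{i=1}^m \beta_i x_i \in \mathbb{R}^d$; $\beta$ is not assumed to be a weight. For $f \colon \mathbb{R}^d \to \mathbb{R}_{\geq 0}$, $S(f) = \{ x \in \mathbb{R}^d \mid f(x) > 0 \}$, and $\| f \|_1$ is the $L^1$ norm with respect to Lebesgue measure. The power transform $Q_d \colon [-\infty, 1/d] \to [-\infty, \infty]$ is $Q_d(p) = \frac{p}{1 - dp}$ for $-\infty < p < 1/d$, $Q_d(-\infty) = -1/d$, and $Q_d(1/d) = \infty$. *)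

theory Defs
  imports "HOL-Probability.Probability"
begin

definition is_weight :: "('m::finite \<Rightarrow> real) \<Rightarrow> bool" where
  "is_weight lam \<longleftrightarrow> (\<forall>i. 0 < lam i) \<and> (\<Sum>i\<in>UNIV. lam i) = 1"

(* Only meant for tuples a of nonnegative reals. Real powers follow the convention
   0 powr s = 0, which agrees with the usual one wherever it is relevant below: the
   exponents lam i are positive, and a zero base meets a negative exponent p only in
   the fourth case, which returns 0 before the powers are evaluated. *)
definition power_mean :: "ereal \<Rightarrow> ('m::finite \<Rightarrow> real) \<Rightarrow> ('m \<Rightarrow> real) \<Rightarrow> real" where
  "power_mean p lam a =
     (if p = 0 then \<Prod>i\<in>UNIV. a i powr lam i
      else if p = -\<infinity> then Min (range a)
      else if p = \<infinity> then Max (range a)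
      else if p \<le> 0 \<and> (\<Prod>i\<in>UNIV. a i) = 0 then 0
      else (\<Sum>i\<in>UNIV. lam i * a i powr real_of_ereal p) powr (1 / real_of_ereal p))"

(* Q_d; its domain is {p. p \<le> ereal (1 / real d)}, and values outside it are irrelevant. *)
definition power_transform :: "nat \<Rightarrow> ereal \<Rightarrow> ereal" where
  "power_transform d p =
     (if p = -\<infinity> then ereal (- (1 / real d))
      else if p = ereal (1 / real d) then \<infinity>
      else ereal (real_of_ereal p / (1 - real d * real_of_ereal p)))"

definition z_comb :: "('m::finite \<Rightarrow> real) \<Rightarrow> (real^'d)^'m \<Rightarrow> real^'d" where
  "z_comb \<beta> x = (\<Sum>i\<in>UNIV. \<beta> i *\<^sub>R (x $ i))"

definition pos_set :: "('a \<Rightarrow> real) \<Rightarrow> 'a set" where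
  "pos_set f = {x. 0 < f x}"

definition L1_norm :: "(real^'d \<Rightarrow> real) \<Rightarrow> real" where
  "L1_norm f = (\<integral>x. \<bar>f x\<bar> \<partial>lebesgue)"

definition ess_inf :: "'a measure \<Rightarrow> ('a \<Rightarrow> ereal) \<Rightarrow> ereal" where
  "ess_inf M f = Sup {c. AE x in M. c \<le> f x}"

(* The library only has the essential supremum, which is set to \<infinity> for
   non-measurable functions; on measurable functions ess_inf is its dual. *)
lemma ess_inf_eq_uminus_esssup:
  assumes "f \<in> borel_measurable M"
  shows "ess_inf M f = - esssup M (\<lambda>x. - f x)"
proof -
  have "(\<lambda>x. - f x) \<in> borel_measurable M"
    using assms by simp
  then have "esssup M (\<lambda>x. - f x) = Inf {z. AE x in M. - f x \<le> z}"
    by (rule esssup_eq_AE)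
  also have "{z. AE x in M. - f x \<le> z} = uminus ` {c. AE x in M. c \<le> f x}"
  proof (intro set_eqI iffI)
    fix z assume "z \<in> {z. AE x in M. - f x \<le> z}"
    then have "- z \<in> {c. AE x in M. c \<le> f x}"
      by (simp add: ereal_uminus_le_reorder)
    then show "z \<in> uminus ` {c. AE x in M. c \<le> f x}"
      by (intro image_eqI[where x = "- z"]) simp_all
  qed auto
  also have "Inf (uminus ` {c. AE x in M. c \<le> f x}) = - ess_inf M f"
    unfolding ess_inf_def by (rule ereal_Inf_uminus_image_eq)
  finally show ?thesis by simp
qed

end

theory Submission
  imports Defs
begin

text \<open>On the line, the bound \<open>M_p(u v) \<le> M_q(u) M_1(v)\<close> with \<open>q = Q_1(p)\<close> replaces the power mean by a linear
  combination \<open>h\<close> of the \<open>g i\<close>, where \<open>u i\<close> is the \<open>i\<close>-th argument of the mean to be bounded below. If the \<open>f i\<close>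
  attain maxima \<open>a i\<close>, the superlevel set \<open>{K s \<le> M_q(u) h}\<close> contains almost all sums \<open>\<Sum> \<beta> i x i\<close> of points with
  \<open>f i (x i) \<ge> a i s\<close>, so the one-dimensional essential Brunn-Minkowski inequality bounds its length from
  below; integrating over \<open>s\<close> in \<open>(0, 1]\<close> gives the claim. In higher dimension one integrates out one
  coordinate at a time, as \<open>Q_1 \<circ> Q_k = Q_(k+1)\<close>. The essential infimum passes to lines by Fubini:
  a property that holds almost everywhere holds almost everywhere on almost every translate of a subspace.\<close>

section \<open>Weighted power means\<close>

text \<open>The obstacle is that nothing is known pointwise: the mean is bounded below only off a
  null set, so true sumsets and extreme points of superlevel sets are of no use. Brunn-Minkowski is
  therefore stated for any Borel set that contains almost all sums. The \<open>f i\<close> are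
  replaced by minorants attaining their maxima on non-null sets, because a null summand would make
  the hypothesis on sums vacuous; taking \<open>s\<close> relative to the separate maxima
  \<open>a i\<close> keeps all superlevel sets non-null for the same \<open>s\<close>. The
  coefficients of \<open>h\<close> are forced by the target: with \<open>F i\<close>,
  \<open>G i\<close> the integrals of \<open>f i\<close>, \<open>g i\<close> and
  \<open>u i = lam i / \<bar>\<beta> i\<bar> * (G i / F i)\<close>, the weight
  \<open>lam i / (u i * a i)\<close> turns \<open>G i > 0\<close> into
  \<open>\<bar>\<beta> i\<bar> * F i / a i\<close>. The lengths on the other side integrate to at
  least the same sum up to a factor tending to 1, so the arbitrary \<open>a i\<close> cancel.
  Integrating out a coordinate may produce the values 0 and infinity, hence functions into
  \<open>ennreal\<close> and hypotheses conditional on positivity and finiteness.\<close>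

lemma is_weightD:
  assumes "is_weight lam"
  shows "0 < lam i" and "0 \<le> lam i" and "(\<Sum>i\<in>UNIV. lam i) = 1"
  using assms by (auto simp: is_weight_def intro: less_imp_le)

lemma power_mean_nonneg:
  assumes "is_weight lam" "\<And>i. 0 \<le> a i"
  shows "0 \<le> power_mean p lam a"
proof -
  have "Min (range a) \<in> range a" "Max (range a) \<in> range a"
    by (auto intro!: Min_in Max_in)
  then have "0 \<le> Min (range a)" "0 \<le> Max (range a)"
    using assms(2) by fastforce+
  then show ?thesis
    using assms is_weightD(2)[OF assms(1)]
    by (auto simp: power_mean_def intro!: prod_nonneg sum_nonneg)
qed

lemma Youngs_inequality_powr:
  fixes a b \<theta> :: real
  assumes "0 < \<theta>" "\<theta> < 1" "0 \<le> a" "0 \<le> b"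
  shows "a powr \<theta> * b powr (1 - \<theta>) \<le> \<theta> * a + (1 - \<theta>) * b"
proof (cases "a = 0 \<or> b = 0")
  case True
  then show ?thesis using assms by auto
next
  case False
  then show ?thesis using Youngs_inequality_0[of \<theta> "1 - \<theta>" a b] assms by simp
qed

text \<open>Young's inequality applied to \<open>x i / X\<close> and \<open>y i / Y\<close>, whose
  weighted sums are 1. If \<open>X\<close> or \<open>Y\<close> is 0, every term on the left
  vanishes.\<close>

lemma Holder_inequality_weighted_sum:
  fixes lam x y :: "'m \<Rightarrow> real"
  assumes "finite I" "\<And>i. i \<in> I \<Longrightarrow> 0 \<le> lam i" "\<And>i. i \<in> I \<Longrightarrow> 0 \<le> x i" "\<And>i. i \<in> I \<Longrightarrow> 0 \<le> y i"
    and \<theta>: "0 < \<theta>" "\<theta> < 1"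
  shows "(\<Sum>i\<in>I. lam i * (x i powr \<theta> * y i powr (1 - \<theta>)))
       \<le> (\<Sum>i\<in>I. lam i * x i) powr \<theta> * (\<Sum>i\<in>I. lam i * y i) powr (1 - \<theta>)"
proof -
  define X Y where "X = (\<Sum>i\<in>I. lam i * x i)" and "Y = (\<Sum>i\<in>I. lam i * y i)"
  have nn: "0 \<le> X" "0 \<le> Y" using assms by (auto simp: X_def Y_def intro!: sum_nonneg)
  show ?thesis
  proof (cases "X = 0 \<or> Y = 0")
    case True
    have "lam i * (x i powr \<theta> * y i powr (1 - \<theta>)) = 0" if "i \<in> I" for i
    proof -
      have "lam i * x i = 0 \<or> lam i * y i = 0"
        using True that assms(1) sum_nonneg_eq_0_iff[of I "\<lambda>i. lam i * x i"]
          sum_nonneg_eq_0_iff[of I "\<lambda>i. lam i * y i"] assms(2-4)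
        by (auto simp: X_def Y_def)
      then show ?thesis by auto
    qed
    then have "(\<Sum>i\<in>I. lam i * (x i powr \<theta> * y i powr (1 - \<theta>))) = 0"
      by (intro sum.neutral) blast
    then show ?thesis by simp
  next
    case False
    then have pos: "0 < X" "0 < Y" using nn by auto
    have "lam i * (x i powr \<theta> * y i powr (1 - \<theta>))
       \<le> X powr \<theta> * Y powr (1 - \<theta>) * (\<theta> * (lam i * x i / X) + (1 - \<theta>) * (lam i * y i / Y))"
      if "i \<in> I" for i
    proof -
      have "x i powr \<theta> * y i powr (1 - \<theta>)
          = X powr \<theta> * Y powr (1 - \<theta>) * ((x i / X) powr \<theta> * (y i / Y) powr (1 - \<theta>))"
        using pos assms that by (simp add: powr_divide)
      also have "\<dots> \<le> X powr \<theta> * Y powr (1 - \<theta>) * (\<theta> * (x i / X) + (1 - \<theta>) * (y i / Y))"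
        using pos assms that by (intro mult_left_mono Youngs_inequality_powr) auto
      finally have "lam i * (x i powr \<theta> * y i powr (1 - \<theta>))
          \<le> lam i * (X powr \<theta> * Y powr (1 - \<theta>) * (\<theta> * (x i / X) + (1 - \<theta>) * (y i / Y)))"
        using assms that by (intro mult_left_mono) auto
      then show ?thesis by (simp add: algebra_simps)
    qed
    then have "(\<Sum>i\<in>I. lam i * (x i powr \<theta> * y i powr (1 - \<theta>)))
       \<le> (\<Sum>i\<in>I. X powr \<theta> * Y powr (1 - \<theta>) * (\<theta> * (lam i * x i / X) + (1 - \<theta>) * (lam i * y i / Y)))"
      by (rule sum_mono)
    also have "\<dots> = X powr \<theta> * Y powr (1 - \<theta>) * (\<theta> * (X / X) + (1 - \<theta>) * (Y / Y))"
      by (simp only: X_def Y_def sum_distrib_left[symmetric] sum.distrib sum_divide_distrib[symmetric])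
    also have "\<dots> = X powr \<theta> * Y powr (1 - \<theta>)" using pos by simp
    finally show ?thesis by (simp add: X_def Y_def)
  qed
qed

text \<open>The \<open>lam\<close>-weighted sum of \<open>ln t \<le> t - 1\<close> at
  \<open>t = v i / V\<close>, with \<open>V\<close> the arithmetic mean: the terms on the right add
  up to 0.\<close>

lemma weighted_geometric_mean_le_arithmetic:
  assumes "is_weight lam" "\<And>i. 0 \<le> v i"
  shows "(\<Prod>i\<in>UNIV. v i powr lam i) \<le> (\<Sum>i\<in>UNIV. lam i * v i)"
proof (cases "\<exists>i. v i = 0")
  case True
  then have "(\<Prod>i\<in>UNIV. v i powr lam i) = 0"
    by (auto intro: prod_zero)
  moreover have "0 \<le> (\<Sum>i\<in>UNIV. lam i * v i)"
    using assms is_weightD(2)[OF assms(1)] by (intro sum_nonneg) simp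
  ultimately show ?thesis by linarith
next
  case False
  then have v: "0 < v i" for i using assms(2)[of i] by (metis less_eq_real_def)
  define V where "V = (\<Sum>i\<in>UNIV. lam i * v i)"
  have V: "0 < V" unfolding V_def using v is_weightD[OF assms(1)] by (intro sum_pos) auto
  have "(\<Prod>i\<in>UNIV. v i powr lam i) = exp (\<Sum>i\<in>UNIV. lam i * ln (v i))"
    using v by (simp add: powr_def exp_sum less_imp_neq[symmetric])
  also have "(\<Sum>i\<in>UNIV. lam i * ln (v i)) \<le> (\<Sum>i\<in>UNIV. lam i * ln V + (lam i * v i / V - lam i))"
  proof (rule sum_mono)
    fix i
    have "ln (v i / V) \<le> v i / V - 1" using v V by (intro ln_le_minus_one) simp
    then have "ln (v i) \<le> ln V + (v i / V - 1)" using v[of i] V by (simp add: ln_div less_imp_neq[symmetric])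
    then have "lam i * ln (v i) \<le> lam i * (ln V + (v i / V - 1))"
      using is_weightD(2)[OF assms(1)] by (rule mult_left_mono)
    then show "lam i * ln (v i) \<le> lam i * ln V + (lam i * v i / V - lam i)"
      by (simp add: algebra_simps)
  qed
  also have "\<dots> = ln V"
    using V is_weightD(3)[OF assms(1)]
    by (simp add: sum.distrib sum_subtractf sum_divide_distrib[symmetric] sum_distrib_right[symmetric] V_def[symmetric])
  finally show ?thesis using V by (simp add: V_def)
qed

lemma power_mean_finite:
  assumes "p \<noteq> 0"
  shows "power_mean (ereal p) lam a =
    (if p \<le> 0 \<and> (\<Prod>i\<in>UNIV. a i) = 0 then 0 else (\<Sum>i\<in>UNIV. lam i * a i powr p) powr (1 / p))"
  using assms by (auto simp: power_mean_def zero_ereal_def)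

text \<open>Hoelder's inequality for exponents with 1/p = 1/q + 1, the relation that
  \<open>Q_1\<close> encodes away from its special values. At p = 0 it reduces to the inequality of
  arithmetic and geometric means, at p = 1 to bounding \<open>u i\<close> by its maximum, and at
  minus infinity (q = -1) to averaging \<open>m / u i \<le> v i\<close> for the minimum
  \<open>m\<close> of the products.\<close>

lemma power_mean_mult_le:
  fixes lam u v :: "'m::finite \<Rightarrow> real"
  assumes w: "is_weight lam" and p: "p \<le> 1" and u: "\<And>i. 0 \<le> u i" and v: "\<And>i. 0 \<le> v i"
  shows "power_mean p lam (\<lambda>i. u i * v i)
       \<le> power_mean (power_transform 1 p) lam u * (\<Sum>i\<in>UNIV. lam i * v i)"
proof -
  note lam = is_weightD[OF w]
  have sum_nn: "0 \<le> (\<Sum>i\<in>UNIV. lam i * v i)" using lam v by (intro sum_nonneg) auto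
  have rhs_nn: "0 \<le> power_mean (power_transform 1 p) lam u * (\<Sum>i\<in>UNIV. lam i * v i)"
    using power_mean_nonneg[OF w u] sum_nn by simp
  show ?thesis
  proof (cases p)
    case MInf
    let ?m = "Min (range (\<lambda>i. u i * v i))"
    have m: "?m \<le> u i * v i" for i by (rule Min_le) auto
    have lhs: "power_mean p lam (\<lambda>i. u i * v i) = ?m"
      using MInf by (simp add: power_mean_def)
    have q: "power_transform 1 p = ereal (-1)" using MInf by (simp add: power_transform_def)
    show ?thesis
    proof (cases "(\<Prod>i\<in>UNIV. u i) = 0")
      case True
      then obtain i where "u i = 0" by auto
      then show ?thesis using m[of i] lhs rhs_nn by simp
    next
      case False
      then have u': "0 < u i" for i using u[of i] by (metis finite less_eq_real_def prod_zero_iff UNIV_I)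
      define U where "U = (\<Sum>i\<in>UNIV. lam i * u i powr -1)"
      have U: "0 < U" unfolding U_def
        using lam u' by (intro sum_pos) (auto simp: less_imp_neq[symmetric])
      have mu: "?m * u i powr -1 \<le> v i" for i
      proof -
        have "?m / u i \<le> v i" using m[of i] u'[of i] by (simp only: pos_divide_le_eq mult.commute)
        then show ?thesis using u'[of i] by (simp add: powr_minus_divide)
      qed
      have "?m * U = (\<Sum>i\<in>UNIV. lam i * (?m * u i powr -1))"
        unfolding U_def sum_distrib_left by (intro sum.cong refl) (simp only: mult_ac)
      also have "\<dots> \<le> (\<Sum>i\<in>UNIV. lam i * v i)"
        using lam mu by (intro sum_mono mult_left_mono) auto
      finally have "?m \<le> U powr -1 * (\<Sum>i\<in>UNIV. lam i * v i)"
        using U by (simp add: powr_minus field_simps)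
      moreover have "power_mean (ereal (-1)) lam u = U powr -1"
        using False by (subst power_mean_finite) (auto simp: U_def)
      ultimately show ?thesis unfolding lhs q by simp
    qed
  next
    case PInf
    then show ?thesis using p by simp
  next
    case (real r)
    then have r1: "r \<le> 1" using p by (simp add: one_ereal_def)
    consider "r = 0" | "r = 1" | "0 < r" "r < 1" | "r < 0" using r1 by linarith
    then show ?thesis
    proof cases
      case 1
      have "power_transform 1 p = 0" using 1 real by (simp add: power_transform_def zero_ereal_def one_ereal_def)
      moreover have "p = 0" using 1 real by (simp add: zero_ereal_def)
      ultimately have "power_mean p lam (\<lambda>i. u i * v i) =
          power_mean (power_transform 1 p) lam u * (\<Prod>i\<in>UNIV. v i powr lam i)"
        using u v by (simp add: power_mean_def powr_mult prod.distrib)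
      then show ?thesis
        using weighted_geometric_mean_le_arithmetic[OF w v] power_mean_nonneg[OF w u, of "power_transform 1 p"]
        by (simp add: mult_left_mono)
    next
      case 2
      have "power_transform 1 p = \<infinity>" using 2 real by (simp add: power_transform_def)
      then have q: "power_mean (power_transform 1 p) lam u = Max (range u)" by (simp add: power_mean_def)
      have "power_mean p lam (\<lambda>i. u i * v i) = (\<Sum>i\<in>UNIV. lam i * (u i * v i))"
        unfolding real 2 by (subst power_mean_finite) (use lam u v in \<open>auto intro!: sum_nonneg abs_of_nonneg\<close>)
      also have "\<dots> \<le> (\<Sum>i\<in>UNIV. lam i * (Max (range u) * v i))"
        using lam v by (intro sum_mono mult_left_mono mult_right_mono) auto
      finally show ?thesis unfolding q by (simp add: sum_distrib_left mult_ac)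
    next
      case 3
      define q where "q = r / (1 - r)"
      have q: "power_transform 1 p = ereal q" "0 < q" using 3 real by (auto simp: power_transform_def q_def)
      have "(\<Sum>i\<in>UNIV. lam i * (u i * v i) powr r)
          = (\<Sum>i\<in>UNIV. lam i * (v i powr r * (u i powr q) powr (1 - r)))"
        using u v 3 by (simp add: powr_mult powr_powr q_def mult_ac)
      also have "\<dots> \<le> (\<Sum>i\<in>UNIV. lam i * v i) powr r * (\<Sum>i\<in>UNIV. lam i * u i powr q) powr (1 - r)"
        using 3 lam v by (intro Holder_inequality_weighted_sum) auto
      finally have "(\<Sum>i\<in>UNIV. lam i * (u i * v i) powr r) powr (1 / r)
          \<le> ((\<Sum>i\<in>UNIV. lam i * v i) powr r * (\<Sum>i\<in>UNIV. lam i * u i powr q) powr (1 - r)) powr (1 / r)"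
        using 3 lam u v by (intro powr_mono2) (auto intro!: sum_nonneg)
      also have "\<dots> = (\<Sum>i\<in>UNIV. lam i * u i powr q) powr (1 / q) * (\<Sum>i\<in>UNIV. lam i * v i)"
        using 3 lam sum_nn by (simp add: powr_mult powr_powr q_def sum_nonneg mult_ac)
      finally show ?thesis
        using 3 q real by (simp add: power_mean_finite)
    next
      case 4
      show ?thesis
      proof (cases "(\<Prod>i\<in>UNIV. u i * v i) = 0")
        case True
        then show ?thesis using rhs_nn 4 real by (simp add: power_mean_finite)
      next
        case False
        then have uv: "0 < u i" "0 < v i" for i
          using u[of i] v[of i] by (auto simp: less_le)
        define q where "q = r / (1 - r)"
        have q: "power_transform 1 p = ereal q" "q < 0"
          using 4 real by (auto simp: power_transform_def q_def divide_neg_pos)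
        \<comment> \<open>For negative \<open>r\<close> the product changes sides:
          \<open>u i powr q\<close> is split into \<open>((u i * v i) powr r) powr \<theta>\<close>
          and \<open>v i powr (1 - \<theta>)\<close>, the powers of \<open>v i\<close> cancelling
          because \<open>q + (1 - \<theta>) = 0\<close>. Raising Hoelder's inequality to the
          negative power \<open>1 / q\<close> then reverses it.\<close>
        define \<theta> where "\<theta> = 1 / (1 - r)"
        have th: "0 < \<theta>" "\<theta> < 1" "r * \<theta> = q" "q + (1 - \<theta>) = 0"
          using 4 by (auto simp: \<theta>_def q_def field_simps)
        define U V W where "U = (\<Sum>i\<in>UNIV. lam i * u i powr q)" and "V = (\<Sum>i\<in>UNIV. lam i * v i)"
          and "W = (\<Sum>i\<in>UNIV. lam i * (u i * v i) powr r)"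
        have pos: "0 < U" "0 < V" "0 < W"
          unfolding U_def V_def W_def using uv lam by (auto intro!: sum_pos simp: less_imp_neq[symmetric])
        have "u i powr q = ((u i * v i) powr r) powr \<theta> * v i powr (1 - \<theta>)" for i
        proof -
          have "((u i * v i) powr r) powr \<theta> * v i powr (1 - \<theta>) = u i powr q * v i powr (q + (1 - \<theta>))"
            using uv[of i] th(3) by (simp add: powr_mult powr_powr powr_add mult_ac)
          then show ?thesis using uv[of i] th(4) by simp
        qed
        then have "U = (\<Sum>i\<in>UNIV. lam i * (((u i * v i) powr r) powr \<theta> * v i powr (1 - \<theta>)))"
          by (simp add: U_def)
        also have "\<dots> \<le> W powr \<theta> * V powr (1 - \<theta>)"
          unfolding W_def V_def using th lam v by (intro Holder_inequality_weighted_sum) auto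
        finally have "(W powr \<theta> * V powr (1 - \<theta>)) powr (1 / q) \<le> U powr (1 / q)"
          using pos q by (intro powr_mono2') auto
        also have "(W powr \<theta> * V powr (1 - \<theta>)) powr (1 / q) = W powr (1 / r) * V powr -1"
        proof -
          have "\<theta> / q = 1 / r" "(1 - \<theta>) / q = -1" using th q 4 by (auto simp: field_simps)
          then show ?thesis using pos by (simp add: powr_mult powr_powr)
        qed
        finally have "W powr (1 / r) \<le> U powr (1 / q) * V"
          using pos by (simp add: powr_minus field_simps)
        moreover have "(\<Prod>i\<in>UNIV. u i) \<noteq> 0" using uv by (simp add: less_imp_neq[symmetric])
        ultimately show ?thesis
          using q 4 real False by (simp add: power_mean_finite U_def V_def W_def)
      qed
    qed
  qed
qed

text \<open>With \<open>y\<close> the dimension, this says that the denominator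
  \<open>1 - x * r\<close> of the transform stays nonnegative up to stage \<open>y\<close> and can
  vanish only there.\<close>

lemma mult_le_one_of_le:
  fixes r x y :: real
  assumes "r * y \<le> 1" "0 < x" "x \<le> y"
  shows "r * x \<le> 1" and "r * x = 1 \<Longrightarrow> x = y"
proof -
  have "r * x \<le> 0 \<or> 0 < r" using assms(2) by (cases "0 < r") (auto simp: mult_nonpos_nonneg)
  then show le: "r * x \<le> 1"
    using assms mult_left_mono[of x y r] by (smt (verit))
  assume 1: "r * x = 1"
  then have "0 < r" using assms by (metis zero_less_mult_pos2 zero_less_one)
  then have "y \<le> x" using assms 1 by (metis mult_le_cancel_left_pos)
  then show "x = y" using assms by simp
qed

text \<open>Since 1 / Q_k(r) = 1 / r - k for r other than 0 and 1 / k, each application of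
  \<open>Q_1\<close> raises k by one; at minus infinity the values -1 / k obey the same
  recursion.\<close>

lemma power_transform_funpow:
  assumes "p \<le> ereal (1 / real n)" "k \<le> n" "0 < k"
  shows "(power_transform 1 ^^ k) p = power_transform k p"
  using assms(3,2)
proof (induction k rule: nat_induct_non_zero)
  case 1
  then show ?case by simp
next
  case (Suc k)
  then have IH: "(power_transform 1 ^^ k) p = power_transform k p" by simp
  have n: "0 < real n" "0 < real k" "real k + 1 \<le> real n" using Suc by auto
  show ?case
  proof (cases p)
    case (real r)
    have rn: "r * real n \<le> 1" using assms(1) real n by (simp add: field_simps)
    have r: "r * (real k + 1) \<le> 1" "r * (real k + 1) = 1 \<Longrightarrow> real k + 1 = real n"
      using mult_le_one_of_le[OF rn, of "real k + 1"] n by auto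
    have rk: "r * real k < 1"
    proof -
      have "r * real k \<noteq> 1"
        using mult_le_one_of_le(2)[OF rn, of "real k"] n by linarith
      moreover have "r * real k \<le> 1"
        using mult_le_one_of_le(1)[OF rn, of "real k"] n by linarith
      ultimately show ?thesis by linarith
    qed
    have k: "power_transform k p = ereal (r / (1 - real k * r))"
      using real rk n by (auto simp: power_transform_def field_simps)
    \<comment> \<open>\<open>Q_1\<close> sends \<open>r / D\<close> to \<open>r / (D - r)\<close>.
      The pole \<open>D = r\<close> is the case \<open>(k + 1) * r = 1\<close>, where
      \<open>Q_1\<close> is applied to 1 and both sides are infinite.\<close>
    define D where "D = 1 - real k * r"
    have D: "0 < D" using rk by (simp add: D_def mult.commute)
    show ?thesis
    proof (cases "r * (real k + 1) = 1")
      case True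
      then have "D = r" by (simp add: D_def algebra_simps)
      moreover have "r = 1 / (real k + 1)" using True n by (simp add: field_simps)
      ultimately show ?thesis
        using D unfolding funpow.simps comp_def IH k D_def[symmetric]
        by (simp add: power_transform_def real add.commute)
    next
      case False
      then have Dr: "D \<noteq> r" "r \<noteq> 1 / (real k + 1)" using n by (auto simp: D_def field_simps)
      have "r / D / (1 - r / D) = r / (D - r)"
        using D Dr by (simp add: field_simps)
      moreover have "D - r = 1 - (real k + 1) * r" by (simp add: D_def algebra_simps)
      ultimately show ?thesis
        using D Dr unfolding funpow.simps comp_def IH k D_def[symmetric]
        by (simp add: power_transform_def real add.commute)
    qed
  next
    case MInf
    then show ?thesis using n unfolding funpow.simps comp_def IH
      by (auto simp: power_transform_def field_simps)
  qed (use assms in auto)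
qed

text \<open>Supplies the exponent condition of the one-dimensional inequality at every stage: r / (1
  - k r) is at most 1 exactly when (k + 1) r is, given a positive denominator.\<close>

lemma power_transform_le_one:
  assumes "p \<le> ereal (1 / real n)" "k < n"
  shows "(power_transform 1 ^^ k) p \<le> 1"
proof (cases "k = 0")
  case True
  have "ereal (1 / real n) \<le> 1" using assms(2) by (simp add: one_ereal_def)
  then show ?thesis using True assms by (auto intro: order_trans)
next
  case False
  then have eq: "(power_transform 1 ^^ k) p = power_transform k p"
    using power_transform_funpow[OF assms(1), of k] assms(2) by simp
  have n: "0 < real n" "0 < real k" "real k + 1 \<le> real n" using assms(2) False by auto
  show ?thesis
  proof (cases p)
    case (real r)
    have rn: "r * real n \<le> 1" using assms(1) real n by (simp add: field_simps)
    have r: "r * (real k + 1) \<le> 1"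
      using mult_le_one_of_le[OF rn, of "real k + 1"] n by auto
    have rk: "r * real k < 1"
    proof -
      have "r * real k \<noteq> 1"
        using mult_le_one_of_le(2)[OF rn, of "real k"] n by linarith
      moreover have "r * real k \<le> 1"
        using mult_le_one_of_le(1)[OF rn, of "real k"] n by linarith
      ultimately show ?thesis by linarith
    qed
    have k: "power_transform k p = ereal (r / (1 - real k * r))"
      using real rk n by (auto simp: power_transform_def field_simps)
    show ?thesis using r rk unfolding eq k
      by (simp add: field_simps one_ereal_def)
  next
    case MInf
    have "- 1 \<le> 1 / real k" by (rule order_trans[of _ 0]) simp_all
    then show ?thesis using MInf unfolding eq by (simp add: power_transform_def one_ereal_def)
  qed (use assms in auto)
qed

section \<open>Almost everywhere on translated subspaces\<close>

lemma AE_lborel_plus_iff: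
  fixes c :: "'a::euclidean_space"
  assumes "Measurable.pred borel P"
  shows "(AE x in lborel. P (c + x)) \<longleftrightarrow> (AE x in lborel. P x)"
proof -
  have "(AE x in lborel. P x) \<longleftrightarrow> (AE x in distr lborel borel ((+) c). P x)"
    by (subst lborel_distr_plus) (rule refl)
  also have "\<dots> \<longleftrightarrow> (AE x in lborel. P (c + x))"
    using assms by (intro AE_distr_iff) auto
  finally show ?thesis ..
qed

lemma AE_lborel_exists:
  assumes "AE x in (lborel :: 'a::euclidean_space measure). P x"
  shows "\<exists>x. P x"
proof (rule ccontr)
  assume "\<not> ?thesis"
  then have "AE x in (lborel :: 'a measure). False" using assms by simp
  then have "emeasure lborel (UNIV :: 'a set) = 0"
    by (simp add: AE_iff_measurable[of UNIV])
  then show False by simp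
qed

text \<open>After exchanging the quantifiers by Fubini, the inner statement is a translate of
  \<open>P\<close> by the constant \<open>L y\<close>, hence equivalent to \<open>P\<close> almost
  everywhere for each \<open>y\<close>.\<close>

lemma AE_lborel_commute_translate:
  fixes L :: "'w::euclidean_space \<Rightarrow> 'v::euclidean_space"
  assumes [measurable]: "L \<in> borel_measurable borel" "Measurable.pred borel P"
  shows "(AE x in lborel. AE y in lborel. P (x + L y)) \<longleftrightarrow> (AE x in lborel. P x)"
proof -
  have "(AE x in lborel. AE y in lborel. P (x + L y)) \<longleftrightarrow> (AE y in lborel. AE x in lborel. P (x + L y))"
    by (rule lborel_pair.AE_commute) measurable
  also have "\<dots> \<longleftrightarrow> (AE y in (lborel :: 'w measure). AE x in lborel. P x)"
    using AE_lborel_plus_iff[OF assms(2), of "L _"] by (simp only: add.commute)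
  also have "\<dots> \<longleftrightarrow> (AE x in lborel. P x)"
  proof
    assume "AE y in (lborel :: 'w measure). AE x in lborel. P x"
    from AE_lborel_exists[OF this] show "AE x in lborel. P x" by simp
  qed (rule AE_I2)
  finally show ?thesis .
qed

text \<open>\<open>P\<close> may be non-measurable; a Borel null set \<open>N\<close> covering its
  exceptions takes its place in the Fubini argument.\<close>

lemma AE_lborel_fibre:
  fixes L :: "'w::euclidean_space \<Rightarrow> 'v::euclidean_space"
  assumes "AE x in lborel. P x" and [measurable]: "L \<in> borel_measurable borel"
  shows "AE x in lborel. AE y in lborel. P (x + L y)"
proof -
  obtain N where N: "{x \<in> space lborel. \<not> P x} \<subseteq> N" "emeasure lborel N = 0" "N \<in> sets lborel"
    using assms(1) by (rule AE_E)
  then have [measurable]: "N \<in> sets borel" by simp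
  have "AE x in lborel. x \<notin> N" using N by (intro AE_not_in) (auto simp: null_sets_def)
  then have "AE x in lborel. AE y in lborel. x + L y \<notin> N"
    by (subst AE_lborel_commute_translate) measurable
  then show ?thesis
  proof eventually_elim
    case (elim x)
    then show ?case by eventually_elim (use N(1) in auto)
  qed
qed

text \<open>On each fibre \<open>x + L y\<close> the map \<open>T\<close> acts as the translation of
  \<open>y\<close> by \<open>T x\<close>, so a null set pulls back to a null set on every fibre, and
  then on the whole space. It is meant for the coordinate projections and for
  \<open>z_comb \<beta>\<close>.\<close>

lemma AE_lborel_right_inverse:
  fixes L :: "'w::euclidean_space \<Rightarrow> 'v::euclidean_space" and T :: "'v \<Rightarrow> 'w"
  assumes [measurable]: "L \<in> borel_measurable borel" "T \<in> borel_measurable borel"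
    and T: "\<And>x y. T (x + L y) = T x + y" and P: "AE y in lborel. P y"
  shows "AE x in lborel. P (T x)"
proof -
  obtain N where N: "{x \<in> space lborel. \<not> P x} \<subseteq> N" "emeasure lborel N = 0" "N \<in> sets lborel"
    using P by (rule AE_E)
  then have [measurable]: "N \<in> sets borel" by simp
  have "AE y in lborel. y \<notin> N" using N by (intro AE_not_in) (auto simp: null_sets_def)
  then have "AE y in lborel. T x + y \<notin> N" for x
    by (subst AE_lborel_plus_iff) measurable
  then have "AE x in lborel. T x \<notin> N"
    by (subst AE_lborel_commute_translate[of L, symmetric]) (auto simp: T)
  then show ?thesis by eventually_elim (use N(1) in auto)
qed

text \<open>The induction lifts the constraints one coordinate at a time. The conclusion does not
  mention the outer \<open>t\<close>, so a statement holding for almost all values of coordinate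
  \<open>j\<close> in the non-null set \<open>D j\<close> holds outright.\<close>

lemma AE_lborel_Cartesian_exists:
  fixes D :: "'m::finite \<Rightarrow> real set"
  assumes AE: "AE t in (lborel :: (real^'m) measure). P t"
    and D: "\<And>i. D i \<in> sets borel" "\<And>i. emeasure lborel (D i) \<noteq> 0"
  shows "\<exists>t. (\<forall>i. t $ i \<in> D i) \<and> P t"
proof -
  have "AE t in (lborel :: (real^'m) measure). (\<forall>i\<in>- I. t $ i \<in> D i) \<longrightarrow> (\<exists>t. (\<forall>i. t $ i \<in> D i) \<and> P t)"
    if "finite I" for I :: "'m set"
    using that
  proof (induction I rule: finite_induct)
    case empty
    show ?case using AE by eventually_elim auto
  next
    case (insert j I)
    let ?Q = "\<exists>t. (\<forall>i. t $ i \<in> D i) \<and> P t"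
    have "AE t in (lborel :: (real^'m) measure). AE s in (lborel :: real measure).
        (\<forall>i\<in>- I. (t + s *\<^sub>R axis j 1) $ i \<in> D i) \<longrightarrow> ?Q"
      using insert.IH by (rule AE_lborel_fibre) measurable
    then show ?case
    proof eventually_elim
      case (elim t)
      show ?case
      proof
        assume t: "\<forall>i\<in>- insert j I. t $ i \<in> D i"
        have "AE s in lborel. t $ j + s \<in> D j \<longrightarrow> ?Q"
          using elim
        proof eventually_elim
          case (elim s)
          show ?case
          proof
            assume s: "t $ j + s \<in> D j"
            have "(t + s *\<^sub>R axis j 1) $ i \<in> D i" if "i \<in> - I" for i
              using that s t by (cases "i = j") (auto simp: axis_def)
            then show ?Q using elim by blast
          qed
        qed
        then have "AE s in lborel. s \<in> D j \<longrightarrow> ?Q"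
          using D(1) by (subst (asm) AE_lborel_plus_iff[where P = "\<lambda>s. s \<in> D j \<longrightarrow> ?Q"]) auto
        then show ?Q using D[of j] by (cases ?Q) (auto simp: AE_iff_null null_sets_def)
      qed
    qed
  qed
  from this[of UNIV] show ?thesis
    using AE_lborel_exists[where P = "\<lambda>t::real^'m. \<exists>t. (\<forall>i. t $ i \<in> D i) \<and> P t"] by auto
qed

section \<open>Essential Brunn-Minkowski inequality on the line\<close>

lemma borel_measurable_vec_component [measurable (raw)]:
  fixes f :: "'a \<Rightarrow> 'b::real_normed_vector ^ 'n"
  assumes "f \<in> borel_measurable M"
  shows "(\<lambda>x. f x $ i) \<in> borel_measurable M"
  using assms by (rule borel_measurable_continuous_on[rotated]) (intro continuous_intros)

lemma emeasure_lborel_translate: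
  fixes c :: "'a::euclidean_space"
  assumes "A \<in> sets borel"
  shows "emeasure lborel {x. c + x \<in> A} = emeasure lborel A"
proof -
  have "emeasure lborel A = emeasure (distr lborel borel ((+) c)) A"
    by (subst lborel_distr_plus) (rule refl)
  also have "\<dots> = emeasure lborel {x. c + x \<in> A}"
    using assms by (subst emeasure_distr) (auto simp: vimage_def)
  finally show ?thesis ..
qed

text \<open>The distribution function \<open>F\<close> is 1-Lipschitz, so the intermediate value
  theorem yields cut points leaving mass \<open>\<epsilon>\<close> on either side. The two slices
  play the part of the least and the greatest point of \<open>C\<close>.\<close>

lemma trim_bounded_set:
  fixes C :: "real set"
  assumes C[measurable]: "C \<in> sets borel" and "bounded C" and \<epsilon>: "0 < \<epsilon>" "2 * \<epsilon> < measure lborel C"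
  obtains b a where "b \<le> a" "emeasure lborel (C \<inter> {..b}) \<noteq> 0" "emeasure lborel (C \<inter> {a..}) \<noteq> 0"
    "measure lborel C - 2 * \<epsilon> \<le> measure lborel (C \<inter> {b<..<a})"
proof -
  obtain n where n: "C \<subseteq> {-n..n}"
    using \<open>bounded C\<close> unfolding bounded_iff by (metis abs_le_iff atLeastAtMost_iff minus_le_iff real_norm_def subsetI)
  have fm: "A \<inter> C \<in> fmeasurable lborel" if "A \<in> sets borel" for A
  proof (rule fmeasurableI2[of "{-n..n}"])
    show "{-n..n} \<in> fmeasurable lborel" by (metis box_real(2) fmeasurable_cbox)
  qed (use n that in auto)
  have fm': "C \<inter> A \<in> fmeasurable lborel" if "A \<in> sets borel" for A
    using fm[OF that] by (simp add: Int_commute)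
  define F where "F x = measure lborel (C \<inter> {..x})" for x
  have diff: "measure lborel (C \<inter> {x<..y}) = F y - F x" if "x \<le> y" for x y
  proof -
    have "C \<inter> {x<..y} = C \<inter> {..y} - C \<inter> {..x}" by auto
    moreover have "measure lborel (C \<inter> {..y} - C \<inter> {..x}) = F y - F x"
      unfolding F_def using that fmeasurableD2[OF fm'[of "{..y}"]] by (intro measure_Diff) auto
    ultimately show ?thesis by simp
  qed
  have mono: "F x \<le> F y" if "x \<le> y" for x y
    using diff[OF that] measure_nonneg[of lborel "C \<inter> {x<..y}"] by simp
  have lip: "F y - F x \<le> y - x" if "x \<le> y" for x y
  proof -
    have "measure lborel (C \<inter> {x<..y}) \<le> measure lborel {x<..y}"
      by (intro measure_mono_fmeasurable) (auto simp: that fmeasurable_def)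
    then show ?thesis using diff[OF that] that by simp
  qed
  have "1-lipschitz_on UNIV F"
  proof (intro lipschitz_onI)
    fix x y :: real
    show "dist (F x) (F y) \<le> 1 * dist x y"
      using lip[of x y] lip[of y x] mono[of x y] mono[of y x] by (cases "x \<le> y") (auto simp: dist_real_def)
  qed simp
  then have cont: "continuous_on A F" for A
    by (meson continuous_on_subset lipschitz_on_continuous_on subset_UNIV)
  \<comment> \<open>Going one below \<open>-n\<close> makes the intersection empty even when
    \<open>-n\<close> lies in \<open>C\<close>.\<close>
  have "C \<inter> {..-n-1} = {}" "C \<inter> {..n} = C" using n by auto
  then have F: "F (-n-1) = 0" "F n = measure lborel C" by (simp_all add: F_def)
  have n0: "-n-1 \<le> n" using n \<epsilon> F by (cases "n < 0") auto
  obtain b where b: "F b = \<epsilon>" using IVT'[of F "-n-1" \<epsilon> n] F \<epsilon> n0 cont by auto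
  obtain a where a: "F a = measure lborel C - \<epsilon>" using IVT'[of F "-n-1" "measure lborel C - \<epsilon>" n] F \<epsilon> n0 cont by auto
  have ba: "b \<le> a" using mono[of a b] a b \<epsilon> by linarith
  show ?thesis
  proof
    show "b \<le> a" by fact
    show "emeasure lborel (C \<inter> {..b}) \<noteq> 0"
      using b \<epsilon> by (auto simp: F_def measure_def)
    have "measure lborel C \<le> measure lborel (C \<inter> {..a}) + measure lborel (C \<inter> {a..})"
    proof -
      have "C = (C \<inter> {..a}) \<union> (C \<inter> {a..})" by auto
      then show ?thesis using measure_Un_le[of "C \<inter> {..a}" lborel "C \<inter> {a..}"] by auto
    qed
    then show "emeasure lborel (C \<inter> {a..}) \<noteq> 0"
      using a \<epsilon> by (auto simp: F_def measure_def)
    have "F a - F b \<le> measure lborel (C \<inter> {b<..<a}) + measure lborel {a}"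
    proof -
      have "measure lborel (C \<inter> {b<..a}) \<le> measure lborel (C \<inter> {b<..<a} \<union> {a})"
        by (intro measure_mono_fmeasurable fmeasurable.Un fm') (auto simp: fmeasurable_def)
      also have "\<dots> \<le> measure lborel (C \<inter> {b<..<a}) + measure lborel {a}"
        by (intro measure_Un_le) auto
      finally show ?thesis using diff[OF ba] by simp
    qed
    then show "measure lborel C - 2 * \<epsilon> \<le> measure lborel (C \<inter> {b<..<a})"
      using a b by simp
  qed
qed

text \<open>Adding the points of one \<open>Mid j\<close> to a fixed low point of the other sets, or one high point of
  \<open>C j\<close> to the remaining sums, produces two pieces of the essential sumset that lie on different
  sides of a common threshold.\<close>

lemma ess_sumset_above_low_point:
  fixes C Lo Mid Hi :: "'m::finite \<Rightarrow> real set" and a b :: "'m \<Rightarrow> real"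
  assumes "finite I" and B: "B \<in> sets borel"
    and C: "\<And>i. C i \<in> sets borel" and Mid: "\<And>i. Mid i \<in> sets borel" and Hi: "\<And>i. emeasure lborel (Hi i) \<noteq> 0"
    and sub: "\<And>i. Lo i \<subseteq> C i \<inter> {..b i}" "\<And>i. Mid i \<subseteq> C i \<inter> {b i<..<a i}" "\<And>i. Hi i \<subseteq> C i \<inter> {a i..}"
    and ba: "\<And>i. b i \<le> a i" and HiM: "\<And>i. Hi i \<in> sets borel"
    and AE: "AE t in (lborel :: (real^'m) measure). (\<forall>i\<in>I. t $ i \<in> C i) \<longrightarrow> (\<Sum>i\<in>I. t $ i) \<in> B"
  shows "AE t in (lborel :: (real^'m) measure). (\<forall>i\<in>I. t $ i \<in> Lo i) \<longrightarrow>
    (\<Sum>i\<in>I. emeasure lborel (Mid i)) \<le> emeasure lborel (B \<inter> {(\<Sum>i\<in>I. t $ i)<..})"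
  using assms(1) B AE
proof (induction I arbitrary: B rule: finite_induct)
  case empty
  then show ?case by simp
next
  case (insert j I)
  note [measurable] = insert.prems(1) C[of j] C Mid
  have fibre: "AE t in (lborel :: (real^'m) measure). AE s in lborel.
      s \<in> C j \<longrightarrow> (\<forall>i\<in>I. t $ i \<in> C i) \<longrightarrow> s + (\<Sum>i\<in>I. t $ i) \<in> B"
  proof -
    have "AE t in (lborel :: (real^'m) measure). AE s in (lborel :: real measure).
        (\<forall>i\<in>insert j I. (t + s *\<^sub>R axis j 1) $ i \<in> C i) \<longrightarrow> (\<Sum>i\<in>insert j I. (t + s *\<^sub>R axis j 1) $ i) \<in> B"
      using insert.prems(2) by (rule AE_lborel_fibre) measurable
    then show ?thesis
    proof eventually_elim
      case (elim t)
      have eq: "(t + s *\<^sub>R axis j 1) $ i = (if i = j then t $ j + s else t $ i)" for s i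
        by (simp add: axis_def)
      have eqI: "(t + s *\<^sub>R axis j 1) $ i = t $ i" if "i \<in> I" for s i
        using that insert.hyps by (auto simp: axis_def)
      have "(\<Sum>i\<in>I. (t + s *\<^sub>R axis j 1) $ i) = (\<Sum>i\<in>I. t $ i)" for s
        by (intro sum.cong refl eqI)
      moreover have "(\<forall>i\<in>I. (t + s *\<^sub>R axis j 1) $ i \<in> C i) = (\<forall>i\<in>I. t $ i \<in> C i)" for s
        by (simp only: eqI cong: ball_cong)
      ultimately have "AE s in lborel.
          t $ j + s \<in> C j \<longrightarrow> (\<forall>i\<in>I. t $ i \<in> C i) \<longrightarrow> (t $ j + s) + (\<Sum>i\<in>I. t $ i) \<in> B"
        using elim insert.hyps by (simp add: eq imp_conjL)
      then show ?case
        by (subst (asm) AE_lborel_plus_iff[where P = "\<lambda>s. s \<in> C j \<longrightarrow> (\<forall>i\<in>I. t $ i \<in> C i) \<longrightarrow> s + (\<Sum>i\<in>I. t $ i) \<in> B"]) measurable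
    qed
  qed
  then have "AE s in lborel. AE t in (lborel :: (real^'m) measure).
      s \<in> C j \<longrightarrow> (\<forall>i\<in>I. t $ i \<in> C i) \<longrightarrow> s + (\<Sum>i\<in>I. t $ i) \<in> B"
    by (subst lborel_pair.AE_commute) measurable
  moreover have "\<not> (AE s in lborel. s \<notin> Hi j)"
    using Hi[of j] HiM[of j] by (auto simp: AE_iff_null null_sets_def)
  \<comment> \<open>The high point \<open>s\<close> is fixed before \<open>t\<close>, so the
    induction hypothesis can be applied to the translate \<open>{z. s + z \<in> B}\<close>. A
    suitable \<open>s\<close> exists because \<open>Hi j\<close> is non-null.\<close>
  ultimately obtain s where s: "s \<in> Hi j"
    and AE_s: "AE t in (lborel :: (real^'m) measure). s \<in> C j \<longrightarrow> (\<forall>i\<in>I. t $ i \<in> C i) \<longrightarrow> s + (\<Sum>i\<in>I. t $ i) \<in> B"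
    by (metis (mono_tags, lifting) eventually_mono)
  have "AE t in (lborel :: (real^'m) measure). (\<forall>i\<in>I. t $ i \<in> Lo i) \<longrightarrow>
    (\<Sum>i\<in>I. emeasure lborel (Mid i)) \<le> emeasure lborel ({z. s + z \<in> B} \<inter> {(\<Sum>i\<in>I. t $ i)<..})"
  proof (rule insert.IH)
    show "{z. s + z \<in> B} \<in> sets borel" by measurable
    show "AE t in (lborel :: (real^'m) measure). (\<forall>i\<in>I. t $ i \<in> C i) \<longrightarrow> (\<Sum>i\<in>I. t $ i) \<in> {z. s + z \<in> B}"
      using AE_s by eventually_elim (use s sub(3)[of j] in auto)
  qed
  with fibre show ?case
  proof eventually_elim
    case (elim t)
    show ?case
    proof
      assume low: "\<forall>i\<in>insert j I. t $ i \<in> Lo i"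
      define \<sigma> where "\<sigma> = (\<Sum>i\<in>I. t $ i)"
      \<comment> \<open>\<open>X\<close> receives almost all of the translate of
        \<open>Mid j\<close> by \<open>\<sigma>\<close>, \<open>Y\<close> the remaining sums moved
        up by \<open>s\<close>. As \<open>a j \<le> s\<close>, the two are disjoint, and both lie
        above \<open>t $ j + \<sigma>\<close>.\<close>
      define X where "X = B \<inter> {t $ j + \<sigma><..<a j + \<sigma>}"
      define Y where "Y = B \<inter> {s + \<sigma><..}"
      have [measurable]: "X \<in> sets borel" "Y \<in> sets borel" by (simp_all add: X_def Y_def)
      have tj: "t $ j \<le> b j" and sa: "a j \<le> s" and tC: "\<forall>i\<in>I. t $ i \<in> C i"
        using low sub(1)[of j] sub(3)[of j] s sub(1) by blast+
      have "emeasure lborel (Mid j) \<le> emeasure lborel {x. \<sigma> + x \<in> X}"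
      proof (rule emeasure_mono_AE)
        have "AE x in lborel. x \<in> C j \<longrightarrow> x + \<sigma> \<in> B"
          using elim(1) tC by (auto simp: \<sigma>_def)
        then show "AE x in lborel. x \<in> Mid j \<longrightarrow> x \<in> {x. \<sigma> + x \<in> X}"
        proof eventually_elim
          case (elim x)
          then show ?case using sub(2)[of j] tj by (auto simp: X_def add.commute)
        qed
      qed measurable
      also have "\<dots> = emeasure lborel X" by (rule emeasure_lborel_translate) measurable
      finally have X: "emeasure lborel (Mid j) \<le> emeasure lborel X" .
      have "{z. s + z \<in> B} \<inter> {\<sigma><..} = {z. s + z \<in> Y}" by (auto simp: Y_def)
      then have "(\<Sum>i\<in>I. emeasure lborel (Mid i)) \<le> emeasure lborel {z. s + z \<in> Y}"
        using elim(2) low by (simp add: \<sigma>_def)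
      also have "\<dots> = emeasure lborel Y" by (rule emeasure_lborel_translate) measurable
      finally have "(\<Sum>i\<in>insert j I. emeasure lborel (Mid i)) \<le> emeasure lborel X + emeasure lborel Y"
        using X insert.hyps by (simp add: add_mono)
      also have "\<dots> = emeasure lborel (X \<union> Y)"
        using sa by (intro plus_emeasure) (auto simp: X_def Y_def)
      also have "\<dots> \<le> emeasure lborel (B \<inter> {t $ j + \<sigma><..})"
        using sa tj ba[of j] by (intro emeasure_mono) (auto simp: X_def Y_def)
      finally show "(\<Sum>i\<in>insert j I. emeasure lborel (Mid i)) \<le> emeasure lborel (B \<inter> {(\<Sum>i\<in>insert j I. t $ i)<..})"
        using insert.hyps by (simp add: \<sigma>_def)
    qed
  qed
qed

text \<open>Classically, translates of the summands are laid end to end at their extreme points. A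
  single point may be exceptional here, so non-null end slices of mass \<open>\<epsilon>\<close>
  replace it. Each summand loses at most \<open>2 * \<epsilon>\<close>, and
  \<open>\<epsilon>\<close> tends to 0.\<close>

lemma ess_Brunn_Minkowski_line:
  fixes C :: "'m::finite \<Rightarrow> real set"
  assumes C: "\<And>i. C i \<in> sets borel" "\<And>i. bounded (C i)" "\<And>i. emeasure lborel (C i) \<noteq> 0" and B: "B \<in> sets borel"
    and AE: "AE t in (lborel :: (real^'m) measure). (\<forall>i. t $ i \<in> C i) \<longrightarrow> (\<Sum>i\<in>UNIV. t $ i) \<in> B"
  shows "(\<Sum>i\<in>UNIV. emeasure lborel (C i)) \<le> emeasure lborel B"
proof (cases "emeasure lborel B = \<infinity>")
  case False
  then have Bfin: "emeasure lborel B = ennreal (measure lborel B)" by (simp add: emeasure_eq_ennreal_measure)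
  have Cfin: "emeasure lborel (C i) = ennreal (measure lborel (C i))" for i
    using emeasure_bounded_finite[OF C(2)[of i]] by (simp add: emeasure_eq_ennreal_measure)
  then have Cpos: "0 < measure lborel (C i)" for i
    using C(3)[of i] by (metis ennreal_0 measure_nonneg less_eq_real_def)
  define M where "M = Min (range (\<lambda>i. measure lborel (C i)))"
  have M: "0 < M" "M \<le> measure lborel (C i)" for i using Cpos by (auto simp: M_def)
  have "(\<Sum>i\<in>UNIV. measure lborel (C i) - 2 * \<epsilon>) \<le> measure lborel B" if \<epsilon>: "0 < \<epsilon>" "2 * \<epsilon> < M" for \<epsilon>
  proof -
    have "\<exists>b a. b \<le> a \<and> emeasure lborel (C i \<inter> {..b}) \<noteq> 0 \<and> emeasure lborel (C i \<inter> {a..}) \<noteq> 0 \<and>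
        measure lborel (C i) - 2 * \<epsilon> \<le> measure lborel (C i \<inter> {b<..<a})" for i
      using trim_bounded_set[OF C(1)[of i] C(2)[of i], of \<epsilon>] \<epsilon> M(2)[of i] by (metis less_le_trans)
    then obtain b a where ba: "\<And>i. b i \<le> a i" "\<And>i. emeasure lborel (C i \<inter> {..b i}) \<noteq> 0"
      "\<And>i. emeasure lborel (C i \<inter> {a i..}) \<noteq> 0"
      "\<And>i. measure lborel (C i) - 2 * \<epsilon> \<le> measure lborel (C i \<inter> {b i<..<a i})"
      by metis
    have "AE t in (lborel :: (real^'m) measure). (\<forall>i\<in>UNIV. t $ i \<in> C i \<inter> {..b i}) \<longrightarrow>
      (\<Sum>i\<in>UNIV. emeasure lborel (C i \<inter> {b i<..<a i})) \<le> emeasure lborel (B \<inter> {(\<Sum>i\<in>UNIV. t $ i)<..})"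
      by (rule ess_sumset_above_low_point[where C = C and Hi = "\<lambda>i. C i \<inter> {a i..}"])
        (use C B ba AE in auto)
    from AE_lborel_Cartesian_exists[OF this, of "\<lambda>i. C i \<inter> {..b i}"] C(1) ba(2)
    obtain t where "(\<Sum>i\<in>UNIV. emeasure lborel (C i \<inter> {b i<..<a i})) \<le> emeasure lborel (B \<inter> {t<..})"
      by auto
    also have "\<dots> \<le> emeasure lborel B" using B by (intro emeasure_mono) auto
    also have "(\<Sum>i\<in>UNIV. emeasure lborel (C i \<inter> {b i<..<a i})) = ennreal (\<Sum>i\<in>UNIV. measure lborel (C i \<inter> {b i<..<a i}))"
    proof -
      have "emeasure lborel (C i \<inter> {b i<..<a i}) = ennreal (measure lborel (C i \<inter> {b i<..<a i}))" for i
      proof (rule emeasure_eq_ennreal_measure)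
        have "bounded (C i \<inter> {b i<..<a i})" using C(2) by (rule bounded_subset) auto
        then show "emeasure lborel (C i \<inter> {b i<..<a i}) \<noteq> \<top>"
          using emeasure_bounded_finite by (metis less_irrefl infinity_ennreal_def)
      qed
      then show ?thesis by (simp add: sum_ennreal)
    qed
    finally have "(\<Sum>i\<in>UNIV. measure lborel (C i \<inter> {b i<..<a i})) \<le> measure lborel B"
      unfolding Bfin by simp
    moreover have "(\<Sum>i\<in>UNIV. measure lborel (C i) - 2 * \<epsilon>)
        \<le> (\<Sum>i\<in>UNIV. measure lborel (C i \<inter> {b i<..<a i}))"
      by (rule sum_mono) (rule ba(4))
    ultimately show ?thesis by linarith
  qed
  then have *: "(\<Sum>i\<in>UNIV. measure lborel (C i)) \<le> measure lborel B + real CARD('m) * (2 * \<epsilon>)"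
    if "0 < \<epsilon>" "2 * \<epsilon> < M" for \<epsilon>
    using that by (force simp: sum_subtractf)
  have "(\<Sum>i\<in>UNIV. measure lborel (C i)) \<le> measure lborel B"
  proof (rule field_le_epsilon)
    fix e :: real assume e: "0 < e"
    \<comment> \<open>The first bound keeps the total loss below \<open>e\<close>; the second leaves
      room for two disjoint slices in the smallest summand.\<close>
    define \<epsilon> where "\<epsilon> = min (e / (2 * real CARD('m))) (M / 4)"
    have "0 < \<epsilon>" "2 * \<epsilon> < M" "real CARD('m) * (2 * \<epsilon>) \<le> e"
      using e M(1) by (auto simp: \<epsilon>_def min_def field_simps)
    then show "(\<Sum>i\<in>UNIV. measure lborel (C i)) \<le> measure lborel B + e" using *[of \<epsilon>] by linarith
  qed
  then show ?thesis unfolding Bfin Cfin by (simp add: sum_ennreal)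
qed simp

lemma AE_lborel_cart_scale:
  fixes \<beta> :: "'m::finite \<Rightarrow> real"
  assumes \<beta>: "\<And>i. \<beta> i \<noteq> 0" and [measurable]: "Measurable.pred borel P"
    and AE: "AE t in (lborel :: (real^'m) measure). P t"
  shows "AE t in (lborel :: (real^'m) measure). P (\<chi> i. t $ i / \<beta> i)"
proof -
  \<comment> \<open>The diagonal map in terms of \<open>Basis\<close>: \<open>c\<close> takes the
    value \<open>1 / \<beta> i\<close> on \<open>axis i 1\<close>, so the Jacobian factor is a
    nonzero constant and null sets are preserved.\<close>
  define c :: "real^'m \<Rightarrow> real" where "c j = (\<chi> i. 1 / \<beta> i) \<bullet> j" for j
  have c: "c j \<noteq> 0" if "j \<in> Basis" for j
    using that \<beta> by (auto simp: c_def Basis_vec_def inner_axis)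
  have T: "0 + (\<Sum>j\<in>Basis. (c j * (t \<bullet> j)) *\<^sub>R j) = (\<chi> i. t $ i / \<beta> i)" for t :: "real^'m"
  proof (rule euclidean_eqI)
    fix k :: "real^'m" assume k: "k \<in> Basis"
    then have "(0 + (\<Sum>j\<in>Basis. (c j * (t \<bullet> j)) *\<^sub>R j)) \<bullet> k = c k * (t \<bullet> k)"
      by (simp add: inner_sum_left_Basis)
    also have "\<dots> = (\<chi> i. t $ i / \<beta> i) \<bullet> k"
      using k by (auto simp: c_def Basis_vec_def inner_axis)
    finally show "(0 + (\<Sum>j\<in>Basis. (c j * (t \<bullet> j)) *\<^sub>R j)) \<bullet> k = (\<chi> i. t $ i / \<beta> i) \<bullet> k" .
  qed
  have [measurable]: "(\<lambda>t::real^'m. \<chi> i. t $ i / \<beta> i) \<in> borel_measurable borel"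
    unfolding T[symmetric] by measurable
  have dens: "density (distr lborel borel (\<lambda>t::real^'m. \<chi> i. t $ i / \<beta> i)) (\<lambda>_. \<Prod>j\<in>Basis. \<bar>c j\<bar>) = lborel"
    using lborel_affine_euclidean[of c 0, OF c] unfolding T by (rule sym)
  have "AE t in density (distr lborel borel (\<lambda>t::real^'m. \<chi> i. t $ i / \<beta> i)) (\<lambda>_. \<Prod>j\<in>Basis. \<bar>c j\<bar>). P t"
    unfolding dens by (rule AE)
  moreover have "0 < (\<Prod>j\<in>Basis. \<bar>c j\<bar>)" using c by (intro prod_pos) auto
  ultimately have "AE t in distr lborel borel (\<lambda>t::real^'m. \<chi> i. t $ i / \<beta> i). P t"
    by (subst (asm) AE_density) auto
  then show ?thesis by (subst (asm) AE_distr_iff) auto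
qed

lemma emeasure_lborel_scale:
  fixes A :: "real set"
  assumes [measurable]: "A \<in> sets borel" and "b \<noteq> 0"
  shows "emeasure lborel {x. x / b \<in> A} = ennreal \<bar>b\<bar> * emeasure lborel A"
proof -
  have [measurable]: "{x. x / b \<in> A} \<in> sets borel" by measurable
  have "emeasure lborel {x. x / b \<in> A} = (\<integral>\<^sup>+x. indicator {x. x / b \<in> A} x \<partial>lborel)" by simp
  also have "\<dots> = ennreal \<bar>b\<bar> * (\<integral>\<^sup>+x. indicator {x. x / b \<in> A} (0 + b * x) \<partial>lborel)"
    using assms by (intro nn_integral_real_affine) auto
  also have "(\<lambda>x. indicator {x. x / b \<in> A} (0 + b * x) :: ennreal) = indicator A"
    using assms by (auto simp: indicator_def)
  finally show ?thesis by simp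
qed

lemma ess_Brunn_Minkowski_line_combination:
  fixes A :: "'m::finite \<Rightarrow> real set" and \<beta> :: "'m \<Rightarrow> real"
  assumes \<beta>: "\<And>i. \<beta> i \<noteq> 0"
    and A: "\<And>i. A i \<in> sets borel" "\<And>i. bounded (A i)" "\<And>i. emeasure lborel (A i) \<noteq> 0"
    and B[measurable]: "B \<in> sets borel"
    and AE: "AE t in (lborel :: (real^'m) measure). (\<forall>i. t $ i \<in> A i) \<longrightarrow> (\<Sum>i\<in>UNIV. \<beta> i * t $ i) \<in> B"
  shows "(\<Sum>i\<in>UNIV. ennreal \<bar>\<beta> i\<bar> * emeasure lborel (A i)) \<le> emeasure lborel B"
proof -
  note [measurable] = A(1)
  define C where "C i = {x. x / \<beta> i \<in> A i}" for i
  have C: "emeasure lborel (C i) = ennreal \<bar>\<beta> i\<bar> * emeasure lborel (A i)" for i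
    unfolding C_def using \<beta> A(1) by (intro emeasure_lborel_scale)
  have "(\<Sum>i\<in>UNIV. emeasure lborel (C i)) \<le> emeasure lborel B"
  proof (rule ess_Brunn_Minkowski_line)
    fix i
    show "C i \<in> sets borel" unfolding C_def by measurable
    have "C i \<subseteq> (\<lambda>x. \<beta> i * x) ` A i"
      using \<beta> by (auto simp: C_def image_iff intro!: bexI[of _ "_ / \<beta> i"])
    then show "bounded (C i)"
      using bounded_subset[OF bounded_scaling[OF A(2)[of i], of "\<beta> i"]] by simp
    show "emeasure lborel (C i) \<noteq> 0" using \<beta> A(3)[of i] by (simp add: C)
  next
    have "AE t in (lborel :: (real^'m) measure).
        (\<forall>i. (\<chi> i. t $ i / \<beta> i) $ i \<in> A i) \<longrightarrow> (\<Sum>i\<in>UNIV. \<beta> i * (\<chi> i. t $ i / \<beta> i) $ i) \<in> B"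
      by (rule AE_lborel_cart_scale[OF \<beta> _ AE]) measurable
    then show "AE t in (lborel :: (real^'m) measure). (\<forall>i. t $ i \<in> C i) \<longrightarrow> (\<Sum>i\<in>UNIV. t $ i) \<in> B"
      by eventually_elim (use \<beta> in \<open>simp add: C_def\<close>)
  qed (rule B)
  then show ?thesis by (simp add: C)
qed

section \<open>The inequality on the line\<close>

text \<open>A minorant with values in finitely many levels attains its essential maximum on a set of
  positive measure, which makes all its relative level sets non-null.\<close>

lemma exists_bounded_minorant:
  fixes f :: "real \<Rightarrow> ennreal"
  assumes f[measurable]: "f \<in> borel_measurable borel"
    and pos: "0 < (\<integral>\<^sup>+x. f x \<partial>lborel)" and fin: "(\<integral>\<^sup>+x. f x \<partial>lborel) < \<infinity>"
    and c: "0 < c" "c < 1"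
  obtains \<phi> :: "real \<Rightarrow> real" and a :: real where
    "\<phi> \<in> borel_measurable borel" "0 < a" "\<And>x. 0 \<le> \<phi> x" "\<And>x. \<phi> x \<le> a" "bounded {x. 0 < \<phi> x}"
    "\<And>x. 0 < \<phi> x \<Longrightarrow> ennreal (\<phi> x) \<le> f x \<and> f x < \<infinity>"
    "emeasure lborel {x. \<phi> x = a} \<noteq> 0"
    "ennreal c * (\<integral>\<^sup>+x. f x \<partial>lborel) \<le> (\<integral>\<^sup>+x. ennreal (\<phi> x) \<partial>lborel)"
proof -
  obtain U where U: "\<And>i. simple_function lborel (U i)" "incseq U" "\<And>i x. U i x < top" "\<And>x. (SUP i. U i x) = f x"
    by (rule borel_measurable_implies_simple_function_sequence'[of f lborel]) auto
  \<comment> \<open>Cutting off to growing intervals gives bounded support without changing the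
    supremum.\<close>
  define V where "V i x = U i x * indicator {- real i..real i} x" for i x
  have Vs: "simple_function lborel (V i)" for i
    unfolding V_def using U(1) by (intro simple_function_mult simple_function_indicator) auto
  have Vinc: "incseq V"
  proof (intro incseq_SucI le_funI)
    fix i x
    show "V i x \<le> V (Suc i) x"
      using incseq_SucD[OF U(2), of i] by (auto simp: V_def indicator_def le_fun_def)
  qed
  have Vsup: "(SUP i. V i x) = f x" for x
  proof -
    have "(\<lambda>i. U i x) \<longlonglongrightarrow> f x"
      using LIMSEQ_SUP[of "\<lambda>i. U i x"] U(2,4) by (auto simp: incseq_def le_fun_def)
    moreover have "eventually (\<lambda>i. U i x = V i x) sequentially"
    proof -
      obtain N :: nat where "\<bar>x\<bar> \<le> real N" using real_arch_simple by blast
      then show ?thesis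
        by (intro eventually_sequentiallyI[of N]) (auto simp: V_def indicator_def)
    qed
    ultimately have "(\<lambda>i. V i x) \<longlonglongrightarrow> f x" by (rule Lim_transform_eventually)
    moreover have "(\<lambda>i. V i x) \<longlonglongrightarrow> (SUP i. V i x)"
      using Vinc by (intro LIMSEQ_SUP) (auto simp: incseq_def le_fun_def)
    ultimately show ?thesis using LIMSEQ_unique by blast
  qed
  have "(\<integral>\<^sup>+x. f x \<partial>lborel) = (SUP i. integral\<^sup>N lborel (V i))"
    unfolding Vsup[symmetric]
    by (rule nn_integral_monotone_convergence_SUP[OF Vinc borel_measurable_simple_function[OF Vs]])
  moreover have "ennreal c * (\<integral>\<^sup>+x. f x \<partial>lborel) < (\<integral>\<^sup>+x. f x \<partial>lborel)"
  proof -
    obtain r where r: "(\<integral>\<^sup>+x. f x \<partial>lborel) = ennreal r" "0 < r"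
      using pos fin by (cases "\<integral>\<^sup>+x. f x \<partial>lborel") auto
    then show ?thesis using c by (simp add: ennreal_mult[symmetric] ennreal_lessI)
  qed
  ultimately obtain i where i: "ennreal c * (\<integral>\<^sup>+x. f x \<partial>lborel) < integral\<^sup>N lborel (V i)"
    by (auto simp: less_SUP_iff)
  define v where "v = V i"
  have [measurable]: "v \<in> borel_measurable borel"
    using borel_measurable_simple_function[OF Vs[of i]] by (simp add: v_def)
  have vfin: "finite (range v)" using simple_functionD(1)[OF Vs[of i]] by (simp add: v_def)
  have vle: "v x \<le> f x" for x unfolding v_def Vsup[symmetric] by (rule SUP_upper) simp
  have vtop: "v x < top" for x using U(3)[of i x] by (auto simp: v_def V_def indicator_def)
  have vsupp: "{x. 0 < v x} \<subseteq> {- real i..real i}" by (auto simp: v_def V_def indicator_def)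
  have level[measurable]: "{x. v x = y} \<in> sets borel" for y by measurable
  \<comment> \<open>Discarding values taken only on null sets makes \<open>Max Y\<close> the
    essential maximum of \<open>v\<close>.\<close>
  define Y where "Y = {y \<in> range v. y \<noteq> 0 \<and> emeasure lborel {x. v x = y} \<noteq> 0}"
  have Yfin: "finite Y" using vfin by (simp add: Y_def)
  have AE_Y: "AE x in lborel. v x \<noteq> 0 \<longrightarrow> v x \<in> Y"
  proof -
    have "AE x in lborel. \<forall>y\<in>range v - Y - {0}. x \<notin> {x. v x = y}"
    proof (intro AE_finite_allI AE_not_in)
      show "finite (range v - Y - {0})" using vfin by simp
      show "{x. v x = y} \<in> null_sets lborel" if "y \<in> range v - Y - {0}" for y
        using that by (auto simp: Y_def null_sets_def)
    qed
    then show ?thesis by eventually_elim auto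
  qed
  have "Y \<noteq> {}"
  proof
    assume "Y = {}"
    then have "AE x in lborel. v x = 0" using AE_Y by simp
    then have "integral\<^sup>N lborel v = 0" by (subst nn_integral_0_iff_AE) auto
    then show False using i by (simp add: v_def)
  qed
  then have MY: "Max Y \<in> Y" using Yfin by simp
  then obtain x0 where x0: "Max Y = v x0" by (auto simp: Y_def)
  define a where "a = enn2real (Max Y)"
  have aY: "Max Y = ennreal a" and a: "0 < a"
    using MY vtop[of x0] x0 by (auto simp: a_def Y_def enn2real_positive_iff less_top zero_less_iff_neq_zero)
  \<comment> \<open>The value 0 is substituted only on a null set, which makes the bounds by
    \<open>a\<close> and by a finite \<open>f x\<close> hold everywhere while the integral stays
    that of \<open>v\<close>.\<close>
  define \<phi> where "\<phi> x = (if v x \<le> ennreal a \<and> f x < \<infinity> then enn2real (v x) else 0)" for x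
  have AE_\<phi>: "AE x in lborel. ennreal (\<phi> x) = v x"
  proof -
    have "AE x in lborel. f x \<noteq> \<infinity>" using fin by (intro nn_integral_PInf_AE) auto
    with AE_Y show ?thesis
    proof eventually_elim
      case (elim x)
      then have "v x \<le> ennreal a" using Yfin by (cases "v x = 0") (auto simp: aY[symmetric])
      then show ?case using elim vtop[of x] by (auto simp: \<phi>_def less_top)
    qed
  qed
  have [measurable]: "\<phi> \<in> borel_measurable borel" unfolding \<phi>_def by measurable
  show ?thesis
  proof
    show "0 \<le> \<phi> x" for x by (simp add: \<phi>_def)
    show "\<phi> x \<le> a" for x
      using a by (auto simp: \<phi>_def intro: enn2real_leI)
    have "{x. 0 < \<phi> x} \<subseteq> {- real i..real i}"
      using vsupp by (auto simp: \<phi>_def enn2real_positive_iff split: if_splits)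
    then show "bounded {x. 0 < \<phi> x}" by (rule bounded_subset[rotated]) simp
    show "ennreal (\<phi> x) \<le> f x \<and> f x < \<infinity>" if "0 < \<phi> x" for x
      using that vle[of x] vtop[of x] by (auto simp: \<phi>_def split: if_splits)
    have "emeasure lborel {x. v x = ennreal a} \<le> emeasure lborel {x. \<phi> x = a}"
    proof (rule emeasure_mono_AE)
      show "AE x in lborel. x \<in> {x. v x = ennreal a} \<longrightarrow> x \<in> {x. \<phi> x = a}"
        using AE_\<phi> by eventually_elim (use a in \<open>auto simp: \<phi>_def split: if_splits\<close>)
    qed measurable
    moreover have "emeasure lborel {x. v x = y} \<noteq> 0" if "y \<in> Y" for y
      using that by (simp add: Y_def)
    from this[OF MY] have "emeasure lborel {x. v x = ennreal a} \<noteq> 0" by (simp add: aY)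
    ultimately show "emeasure lborel {x. \<phi> x = a} \<noteq> 0" by auto
    have "(\<integral>\<^sup>+x. ennreal (\<phi> x) \<partial>lborel) = integral\<^sup>N lborel v"
      using AE_\<phi> by (rule nn_integral_cong_AE)
    then show "ennreal c * (\<integral>\<^sup>+x. f x \<partial>lborel) \<le> (\<integral>\<^sup>+x. ennreal (\<phi> x) \<partial>lborel)"
      using i by (simp add: v_def)
  qed fact+
qed

lemma nn_integral_emeasure_commute:
  fixes P :: "real \<Rightarrow> real \<Rightarrow> bool"
  assumes [measurable]: "Measurable.pred (borel \<Otimes>\<^sub>M borel) (\<lambda>(s, x). P s x)"
  shows "(\<integral>\<^sup>+s. emeasure lborel {x. P s x} \<partial>lborel) = (\<integral>\<^sup>+x. emeasure lborel {s. P s x} \<partial>lborel)"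
proof -
  have [measurable]: "{x. P s x} \<in> sets borel" "{s. P s x} \<in> sets borel" for s x by measurable
  have "(\<integral>\<^sup>+s. emeasure lborel {x. P s x} \<partial>lborel) = (\<integral>\<^sup>+s. (\<integral>\<^sup>+x. of_bool (P s x) \<partial>lborel) \<partial>lborel)"
    by (intro nn_integral_cong) (simp add: nn_integral_indicator[symmetric] indicator_def)
  also have "\<dots> = (\<integral>\<^sup>+x. (\<integral>\<^sup>+s. of_bool (P s x) \<partial>lborel) \<partial>lborel)"
    by (rule lborel_pair.Fubini') measurable
  also have "\<dots> = (\<integral>\<^sup>+x. emeasure lborel {s. P s x} \<partial>lborel)"
    by (intro nn_integral_cong) (simp add: nn_integral_indicator[symmetric] indicator_def)
  finally show ?thesis .
qed

text \<open>Layer-cake formula in relative levels: for fixed \<open>x\<close> the admissible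
  \<open>s\<close> form the interval \<open>{0<..\<phi> x / a}\<close>, which already lies below
  1.\<close>

lemma nn_integral_superlevel_sets:
  fixes \<phi> :: "real \<Rightarrow> real"
  assumes [measurable]: "\<phi> \<in> borel_measurable borel" and a: "0 < a" "\<And>x. 0 \<le> \<phi> x" "\<And>x. \<phi> x \<le> a"
  shows "(\<integral>\<^sup>+s. emeasure lborel {x. s \<in> {0<..1} \<and> a * s \<le> \<phi> x} \<partial>lborel) = ennreal (1 / a) * (\<integral>\<^sup>+x. ennreal (\<phi> x) \<partial>lborel)"
proof -
  have "(\<integral>\<^sup>+s. emeasure lborel {x. s \<in> {0<..1} \<and> a * s \<le> \<phi> x} \<partial>lborel)
      = (\<integral>\<^sup>+x. emeasure lborel {s. s \<in> {0<..1} \<and> a * s \<le> \<phi> x} \<partial>lborel)"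
    by (rule nn_integral_emeasure_commute) measurable
  also have "\<dots> = (\<integral>\<^sup>+x. ennreal (1 / a) * ennreal (\<phi> x) \<partial>lborel)"
  proof (intro nn_integral_cong)
    fix x
    have "{s. s \<in> {0<..1} \<and> a * s \<le> \<phi> x} = {0<..\<phi> x / a}"
    proof -
      have "\<phi> x / a \<le> 1" using a(1) a(3)[of x] by simp
      moreover have "a * s \<le> \<phi> x \<longleftrightarrow> s \<le> \<phi> x / a" for s using a(1) by (simp add: pos_le_divide_eq mult.commute)
      ultimately show ?thesis by (auto intro: order_trans)
    qed
    then show "emeasure lborel {s. s \<in> {0<..1} \<and> a * s \<le> \<phi> x} = ennreal (1 / a) * ennreal (\<phi> x)"
      using a(1) a(2)[of x] by (simp add: ennreal_mult[symmetric])
  qed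
  finally show ?thesis by (simp add: nn_integral_cmult)
qed

text \<open>The layer-cake bound for the side of \<open>h\<close>: the levels \<open>s\<close> lie
  in an interval of length \<open>y / K\<close>, and the cut at 1 may lose part of it, hence only an
  inequality.\<close>

lemma emeasure_linear_le:
  fixes y :: ennreal
  assumes "0 < K"
  shows "ennreal K * emeasure lborel {s. s \<in> {0<..1} \<and> ennreal (K * s) \<le> y} \<le> y"
proof (cases y)
  case (real r)
  have "emeasure lborel {s. s \<in> {0<..1} \<and> ennreal (K * s) \<le> y} \<le> emeasure lborel {0<..r / K}"
  proof (intro emeasure_mono subsetI)
    fix s assume "s \<in> {s. s \<in> {0<..1} \<and> ennreal (K * s) \<le> y}"
    then have "0 < s" "K * s \<le> r" using assms real by (auto simp: ennreal_le_iff)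
    then show "s \<in> {0<..r / K}" using assms by (simp add: pos_le_divide_eq mult.commute)
  qed simp
  then have "ennreal K * emeasure lborel {s. s \<in> {0<..1} \<and> ennreal (K * s) \<le> y} \<le> ennreal K * emeasure lborel {0<..r / K}"
    by (rule mult_left_mono) simp
  also have "\<dots> = y" using assms real by (simp add: ennreal_mult[symmetric])
  finally show ?thesis .
qed simp

text \<open>The pointwise step: the bound on the mean of a product separates the constants
  \<open>u i\<close>, and \<open>a i * s \<le> f i (t $ i)\<close> replaces the denominators by a
  multiple of \<open>s\<close>. What remains depends on \<open>t\<close> only through
  \<open>z\<close>.\<close>

lemma line_superlevel_of_power_mean_bound:
  fixes lam u a :: "'m::finite \<Rightarrow> real" and \<phi> :: "'m \<Rightarrow> real \<Rightarrow> real" and f g :: "'m \<Rightarrow> real \<Rightarrow> ennreal"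
  assumes w: "is_weight lam" and p: "p \<le> 1" and u: "\<And>i. 0 \<le> u i" and a: "\<And>i. 0 < a i" and s: "0 < s"
    and \<phi>: "\<And>i x. 0 < \<phi> i x \<Longrightarrow> ennreal (\<phi> i x) \<le> f i x \<and> f i x < \<infinity>"
    and K: "(\<forall>i. 0 < f i (t $ i) \<and> f i (t $ i) < \<infinity> \<and> g i z < \<infinity>) \<Longrightarrow>
      K \<le> power_mean p lam (\<lambda>i. enn2real (g i z) / enn2real (f i (t $ i)))"
    and z: "\<And>i. g i z < \<infinity>" "\<And>i. u i = 0 \<Longrightarrow> g i z = 0"
    and t: "\<And>i. a i * s \<le> \<phi> i (t $ i)"
  shows "ennreal (K * s) \<le> ennreal (power_mean (power_transform 1 p) lam u) *
    (\<Sum>i\<in>UNIV. ennreal (lam i / (u i * a i)) * g i z)"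
proof -
  note lam = is_weightD[OF w]
  define M where "M = power_mean (power_transform 1 p) lam u"
  have M: "0 \<le> M" unfolding M_def using w u by (rule power_mean_nonneg)
  define \<gamma> where "\<gamma> i = enn2real (g i z)" for i
  define \<psi> where "\<psi> i = enn2real (f i (t $ i))" for i
  have g: "g i z = ennreal (\<gamma> i)" "0 \<le> \<gamma> i" for i using z(1)[of i] by (simp_all add: \<gamma>_def less_top)
  have as: "0 < a i * s" for i using a s by simp
  have \<phi>pos: "0 < \<phi> i (t $ i)" for i using as[of i] t[of i] by linarith
  have f: "0 < f i (t $ i)" "f i (t $ i) < \<infinity>" "a i * s \<le> \<psi> i" for i
  proof -
    have le: "ennreal (\<phi> i (t $ i)) \<le> f i (t $ i)" "f i (t $ i) < \<infinity>" using \<phi>[OF \<phi>pos[of i]] by auto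
    then show "f i (t $ i) < \<infinity>" by simp
    have "0 < ennreal (\<phi> i (t $ i))" using \<phi>pos[of i] by simp
    then show "0 < f i (t $ i)" using le(1) by (rule less_le_trans)
    have "\<phi> i (t $ i) \<le> \<psi> i" unfolding \<psi>_def
      using le \<phi>pos[of i] enn2real_mono[OF le(1)] by (simp add: less_top)
    then show "a i * s \<le> \<psi> i" using t[of i] by linarith
  qed
  \<comment> \<open>For \<open>u i = 0\<close> division by zero gives \<open>v i = 0\<close>, and
    \<open>u i * v i = \<gamma> i / \<psi> i\<close> still holds because
    \<open>\<gamma> i = 0\<close>.\<close>
  define v where "v i = \<gamma> i / (u i * \<psi> i)" for i
  have \<psi>: "0 < \<psi> i" for i using f(3)[of i] as[of i] by linarith
  have "K \<le> power_mean p lam (\<lambda>i. \<gamma> i / \<psi> i)"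
    using K f z(1) by (simp add: \<gamma>_def \<psi>_def)
  also have "(\<lambda>i. \<gamma> i / \<psi> i) = (\<lambda>i. u i * v i)"
  proof
    fix i show "\<gamma> i / \<psi> i = u i * v i"
      using z(2)[of i] by (cases "u i = 0") (auto simp: v_def \<gamma>_def)
  qed
  also have "power_mean p lam \<dots> \<le> M * (\<Sum>i\<in>UNIV. lam i * v i)"
    unfolding M_def using w p u
    by (rule power_mean_mult_le) (use u \<psi> g in \<open>simp add: v_def less_imp_le\<close>)
  also have "\<dots> \<le> M * (\<Sum>i\<in>UNIV. lam i / (u i * a i) * \<gamma> i / s)"
  proof (intro mult_left_mono sum_mono)
    fix i
    have "v i \<le> \<gamma> i / (u i * (a i * s))"
    proof (cases "u i = 0")
      case False
      then have "0 < u i" using u[of i] by simp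
      then show ?thesis unfolding v_def using f(3)[of i] as[of i] g(2)[of i] \<psi>[of i] a[of i] s
        by (intro divide_left_mono mult_left_mono mult_pos_pos) auto
    qed (simp add: v_def)
    then have "lam i * v i \<le> lam i * (\<gamma> i / (u i * (a i * s)))" using lam(2) by (rule mult_left_mono)
    then show "lam i * v i \<le> lam i / (u i * a i) * \<gamma> i / s" by (simp add: mult_ac)
  qed (rule M)
  finally have "K * s \<le> M * (\<Sum>i\<in>UNIV. lam i / (u i * a i) * \<gamma> i)"
    using s by (simp only: sum_divide_distrib[symmetric] times_divide_eq_right pos_le_divide_eq)
  then have "ennreal (K * s) \<le> ennreal (M * (\<Sum>i\<in>UNIV. lam i / (u i * a i) * \<gamma> i))"
    by (rule ennreal_leI)
  also have "\<dots> = ennreal M * (\<Sum>i\<in>UNIV. ennreal (lam i / (u i * a i)) * g i z)"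
  proof -
    have nn: "0 \<le> lam i / (u i * a i)" for i using lam(2)[of i] u[of i] a[of i] by (simp add: less_imp_le)
    have "ennreal (lam i / (u i * a i)) * g i z = ennreal (lam i / (u i * a i) * \<gamma> i)" for i
      unfolding g(1) using nn g(2) by (rule ennreal_mult[symmetric])
    moreover have "0 \<le> lam i / (u i * a i) * \<gamma> i" for i using nn g(2) by (rule mult_nonneg_nonneg)
    ultimately have "(\<Sum>i\<in>UNIV. ennreal (lam i / (u i * a i)) * g i z) = ennreal (\<Sum>i\<in>UNIV. lam i / (u i * a i) * \<gamma> i)"
      by (simp only: sum_ennreal)
    moreover have "0 \<le> (\<Sum>i\<in>UNIV. lam i / (u i * a i) * \<gamma> i)"
      by (intro sum_nonneg mult_nonneg_nonneg nn g(2))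
    ultimately show ?thesis using M by (simp only: ennreal_mult)
  qed
  finally show ?thesis by (simp add: M_def)
qed

text \<open>A minorant can be required to carry only a fraction \<open>c < 1\<close> of the integral
  of \<open>f i\<close>, so the argument yields \<open>c * K \<le> M\<close> for every such
  \<open>c\<close>. For \<open>K \<le> 0\<close> nonnegativity of the mean suffices.\<close>

lemma line_inequality:
  fixes lam \<beta> :: "'m::finite \<Rightarrow> real" and f g :: "'m \<Rightarrow> real \<Rightarrow> ennreal"
  assumes w: "is_weight lam" and p: "p \<le> 1" and \<beta>: "\<And>i. \<beta> i \<noteq> 0"
    and f[measurable]: "\<And>i. f i \<in> borel_measurable borel" and g[measurable]: "\<And>i. g i \<in> borel_measurable borel"
    and fpos: "\<And>i. 0 < (\<integral>\<^sup>+x. f i x \<partial>lborel)" and ffin: "\<And>i. (\<integral>\<^sup>+x. f i x \<partial>lborel) < \<infinity>"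
    and gfin: "\<And>i. (\<integral>\<^sup>+x. g i x \<partial>lborel) < \<infinity>"
    and AE: "AE t in (lborel :: (real^'m) measure).
      (\<forall>i. 0 < f i (t $ i) \<and> f i (t $ i) < \<infinity> \<and> g i (\<Sum>i\<in>UNIV. \<beta> i * t $ i) < \<infinity>) \<longrightarrow>
      K \<le> power_mean p lam (\<lambda>i. enn2real (g i (\<Sum>i\<in>UNIV. \<beta> i * t $ i)) / enn2real (f i (t $ i)))"
  shows "K \<le> power_mean (power_transform 1 p) lam
    (\<lambda>i. lam i / \<bar>\<beta> i\<bar> * (enn2real (\<integral>\<^sup>+x. g i x \<partial>lborel) / enn2real (\<integral>\<^sup>+x. f i x \<partial>lborel)))"
proof (cases "0 < K")
  case K: True
  note lam = is_weightD[OF w]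
  define F G where "F i = enn2real (\<integral>\<^sup>+x. f i x \<partial>lborel)" and "G i = enn2real (\<integral>\<^sup>+x. g i x \<partial>lborel)" for i
  have F: "(\<integral>\<^sup>+x. f i x \<partial>lborel) = ennreal (F i)" "0 < F i" for i
    using fpos[of i] ffin[of i] by (simp_all add: F_def less_top enn2real_positive_iff)
  have G: "(\<integral>\<^sup>+x. g i x \<partial>lborel) = ennreal (G i)" "0 \<le> G i" for i
    using gfin[of i] by (simp_all add: G_def less_top)
  define u where "u i = lam i / \<bar>\<beta> i\<bar> * (G i / F i)" for i
  have u: "0 \<le> u i" for i using lam(2) F(2)[of i] G(2)[of i] by (simp add: u_def)
  have u0: "u i = 0 \<longleftrightarrow> G i = 0" for i using lam(1)[of i] \<beta>[of i] F(2)[of i] by (auto simp: u_def)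
  define M where "M = power_mean (power_transform 1 p) lam u"
  have M: "0 \<le> M" unfolding M_def using w u by (rule power_mean_nonneg)
  have "c * K \<le> M" if c: "0 < c" "c < 1" for c
  proof -
    have "\<exists>\<phi> a. \<phi> \<in> borel_measurable borel \<and> 0 < a \<and> (\<forall>x. 0 \<le> \<phi> x) \<and> (\<forall>x. \<phi> x \<le> a) \<and> bounded {x. 0 < \<phi> x} \<and>
        (\<forall>x. 0 < \<phi> x \<longrightarrow> ennreal (\<phi> x) \<le> f i x \<and> f i x < \<infinity>) \<and> emeasure lborel {x. \<phi> x = a} \<noteq> 0 \<and>
        ennreal c * (\<integral>\<^sup>+x. f i x \<partial>lborel) \<le> (\<integral>\<^sup>+x. ennreal (\<phi> x) \<partial>lborel)" for i
      using exists_bounded_minorant[OF f fpos ffin c, of i] by metis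
    then obtain \<phi> a where \<phi>[measurable]: "\<And>i. \<phi> i \<in> borel_measurable borel" and a: "\<And>i. 0 < a i"
      and \<phi>0: "\<And>i x. 0 \<le> \<phi> i x" "\<And>i x. \<phi> i x \<le> a i" and bdd: "\<And>i. bounded {x. 0 < \<phi> i x}"
      and \<phi>f: "\<And>i x. 0 < \<phi> i x \<Longrightarrow> ennreal (\<phi> i x) \<le> f i x \<and> f i x < \<infinity>"
      and top: "\<And>i. emeasure lborel {x. \<phi> i x = a i} \<noteq> 0"
      and c\<phi>: "\<And>i. ennreal c * (\<integral>\<^sup>+x. f i x \<partial>lborel) \<le> (\<integral>\<^sup>+x. ennreal (\<phi> i x) \<partial>lborel)"
      by metis
    define h where "h z = (\<Sum>i\<in>UNIV. ennreal (lam i / (u i * a i)) * g i z)" for z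
    have [measurable]: "h \<in> borel_measurable borel" unfolding h_def by measurable
    \<comment> \<open>If \<open>u i = 0\<close>, the coefficient of \<open>g i\<close> in
      \<open>h\<close> is 0 by division by zero; this is harmless because \<open>G i = 0\<close>
      then, so \<open>g i\<close> vanishes almost everywhere.\<close>
    define good where "good z \<longleftrightarrow> (\<forall>i. g i z < \<infinity> \<and> (u i = 0 \<longrightarrow> g i z = 0))" for z
    have [measurable]: "Measurable.pred borel good" unfolding good_def by measurable
    have AE_good: "AE z in lborel. good z"
    proof -
      have "AE z in lborel. g i z < \<infinity> \<and> (u i = 0 \<longrightarrow> g i z = 0)" for i
      proof -
        have "AE z in lborel. g i z \<noteq> \<infinity>"
          using gfin[of i] by (intro nn_integral_PInf_AE) auto
        moreover have "AE z in lborel. u i = 0 \<longrightarrow> g i z = 0"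
        proof (cases "u i = 0")
          case True
          then have "(\<integral>\<^sup>+z. g i z \<partial>lborel) = 0" using G(1)[of i] by (simp add: u0)
          then show ?thesis by (subst (asm) nn_integral_0_iff_AE) auto
        qed simp
        ultimately show ?thesis by eventually_elim (auto simp: less_top)
      qed
      then show ?thesis unfolding good_def by (intro AE_all_countable[THEN iffD2] allI)
    qed
    have BM: "(\<Sum>i\<in>UNIV. ennreal \<bar>\<beta> i\<bar> * emeasure lborel {x. s \<in> {0<..1} \<and> a i * s \<le> \<phi> i x})
        \<le> emeasure lborel {z. s \<in> {0<..1} \<and> ennreal (K * s) \<le> ennreal M * h z}" for s
    proof (cases "s \<in> {0<..1}")
      case True
      then have s: "0 < s" "s \<le> 1" by auto
      \<comment> \<open>The target set admits all bad \<open>z\<close>, so bad sums need not be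
        shown to be rare; since bad points form a null set, its measure is unaffected.\<close>
      have "(\<Sum>i\<in>UNIV. ennreal \<bar>\<beta> i\<bar> * emeasure lborel {x. a i * s \<le> \<phi> i x})
          \<le> emeasure lborel {z. good z \<longrightarrow> ennreal (K * s) \<le> ennreal M * h z}"
      proof (rule ess_Brunn_Minkowski_line_combination)
        fix i
        show "{x. a i * s \<le> \<phi> i x} \<in> sets borel" by measurable
        have "{x. a i * s \<le> \<phi> i x} \<subseteq> {x. 0 < \<phi> i x}" using a[of i] s by (auto intro: less_le_trans[OF mult_pos_pos])
        then show "bounded {x. a i * s \<le> \<phi> i x}" by (rule bounded_subset[OF bdd])
        have "emeasure lborel {x. \<phi> i x = a i} \<le> emeasure lborel {x. a i * s \<le> \<phi> i x}"
          using a[of i] s by (intro emeasure_mono) auto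
        then show "emeasure lborel {x. a i * s \<le> \<phi> i x} \<noteq> 0" using top[of i] by auto
      next
        show "{z. good z \<longrightarrow> ennreal (K * s) \<le> ennreal M * h z} \<in> sets borel" by measurable
        show "AE t in (lborel :: (real^'m) measure). (\<forall>i. t $ i \<in> {x. a i * s \<le> \<phi> i x}) \<longrightarrow>
            (\<Sum>i\<in>UNIV. \<beta> i * t $ i) \<in> {z. good z \<longrightarrow> ennreal (K * s) \<le> ennreal M * h z}"
          using AE
        proof eventually_elim
          case (elim t)
          show ?case
          proof (intro impI CollectI)
            assume t: "\<forall>i. t $ i \<in> {x. a i * s \<le> \<phi> i x}" and z: "good (\<Sum>i\<in>UNIV. \<beta> i * t $ i)"
            show "ennreal (K * s) \<le> ennreal M * h (\<Sum>i\<in>UNIV. \<beta> i * t $ i)"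
              unfolding M_def h_def
              by (rule line_superlevel_of_power_mean_bound[where f = f and \<phi> = \<phi> and t = t, OF w p u a s(1) \<phi>f])
                 (use elim t z in \<open>auto simp: good_def\<close>)
          qed
        qed
      qed (rule \<beta>)
      also have "\<dots> \<le> emeasure lborel {z. ennreal (K * s) \<le> ennreal M * h z}"
        using AE_good by (intro emeasure_mono_AE) (auto elim: eventually_mono)
      finally show ?thesis using True by simp
    next
      case False
      then have "(s \<in> {0<..1}) = False" by blast
      then show ?thesis by (simp only:) simp
    qed
    have "(\<Sum>i\<in>UNIV. ennreal \<bar>\<beta> i\<bar> * (ennreal (1 / a i) * (\<integral>\<^sup>+x. ennreal (\<phi> i x) \<partial>lborel)))
        = (\<integral>\<^sup>+s. (\<Sum>i\<in>UNIV. ennreal \<bar>\<beta> i\<bar> * emeasure lborel {x. s \<in> {0<..1} \<and> a i * s \<le> \<phi> i x}) \<partial>lborel)"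
    proof -
      have [measurable]: "(\<lambda>s. emeasure lborel {x. s \<in> {0<..1} \<and> a i * s \<le> \<phi> i x}) \<in> borel_measurable borel" for i
        by measurable
      show ?thesis
        using nn_integral_superlevel_sets[OF \<phi> a \<phi>0] by (simp add: nn_integral_sum nn_integral_cmult)
    qed
    also have "\<dots> \<le> (\<integral>\<^sup>+s. emeasure lborel {z. s \<in> {0<..1} \<and> ennreal (K * s) \<le> ennreal M * h z} \<partial>lborel)"
      by (intro nn_integral_mono BM)
    also have "\<dots> = (\<integral>\<^sup>+z. emeasure lborel {s. s \<in> {0<..1} \<and> ennreal (K * s) \<le> ennreal M * h z} \<partial>lborel)"
      by (rule nn_integral_emeasure_commute) measurable
    finally have "ennreal K * (\<Sum>i\<in>UNIV. ennreal \<bar>\<beta> i\<bar> * (ennreal (1 / a i) * (\<integral>\<^sup>+x. ennreal (\<phi> i x) \<partial>lborel)))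
        \<le> ennreal K * \<dots>" by (rule mult_left_mono) simp
    also have "\<dots> = (\<integral>\<^sup>+z. ennreal K * emeasure lborel {s. s \<in> {0<..1} \<and> ennreal (K * s) \<le> ennreal M * h z} \<partial>lborel)"
      by (rule nn_integral_cmult[symmetric]) measurable
    also have "\<dots> \<le> (\<integral>\<^sup>+z. ennreal M * h z \<partial>lborel)"
      using K by (intro nn_integral_mono emeasure_linear_le)
    also have "\<dots> = ennreal M * (\<Sum>i\<in>UNIV. ennreal (lam i / (u i * a i)) * ennreal (G i))"
      by (simp add: nn_integral_cmult h_def nn_integral_sum G(1))
    also have "\<dots> \<le> ennreal M * (\<Sum>i\<in>UNIV. ennreal (\<bar>\<beta> i\<bar> * F i / a i))"
    proof (intro mult_left_mono sum_mono)
      fix i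
      \<comment> \<open>An equality when \<open>G i\<close> is nonzero, by the choice of
        \<open>u i\<close>; otherwise the left side is 0.\<close>
      have "lam i / (u i * a i) * G i \<le> \<bar>\<beta> i\<bar> * F i / a i"
      proof (cases "G i = 0")
        case False
        then show ?thesis using lam(1)[of i] \<beta>[of i] F(2)[of i] a[of i] by (simp add: u_def field_simps)
      qed (use F(2)[of i] a[of i] in \<open>simp add: less_imp_le\<close>)
      then show "ennreal (lam i / (u i * a i)) * ennreal (G i) \<le> ennreal (\<bar>\<beta> i\<bar> * F i / a i)"
        using lam(2)[of i] u[of i] a[of i] G(2)[of i] by (simp add: ennreal_mult[symmetric] ennreal_leI less_imp_le)
    qed simp
    finally have le: "ennreal K * (\<Sum>i\<in>UNIV. ennreal \<bar>\<beta> i\<bar> * (ennreal (1 / a i) * (\<integral>\<^sup>+x. ennreal (\<phi> i x) \<partial>lborel)))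
        \<le> ennreal M * (\<Sum>i\<in>UNIV. ennreal (\<bar>\<beta> i\<bar> * F i / a i))" .
    define W where "W = (\<Sum>i\<in>UNIV. \<bar>\<beta> i\<bar> * F i / a i)"
    have W: "0 < W" unfolding W_def using \<beta> F(2) a by (intro sum_pos) auto
    have "ennreal (c * K * W) = ennreal K * (\<Sum>i\<in>UNIV. ennreal \<bar>\<beta> i\<bar> * (ennreal (1 / a i) * (ennreal c * (\<integral>\<^sup>+x. f i x \<partial>lborel))))"
    proof -
      have "ennreal \<bar>\<beta> i\<bar> * (ennreal (1 / a i) * (ennreal c * (\<integral>\<^sup>+x. f i x \<partial>lborel))) = ennreal (c * (\<bar>\<beta> i\<bar> * F i / a i))" for i
        using c F(2)[of i] a[of i] unfolding F(1) by (simp add: ennreal_mult[symmetric] less_imp_le mult_ac)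
      moreover have "0 \<le> c * (\<bar>\<beta> i\<bar> * F i / a i)" for i using c F(2)[of i] a[of i] by simp
      ultimately have "(\<Sum>i\<in>UNIV. ennreal \<bar>\<beta> i\<bar> * (ennreal (1 / a i) * (ennreal c * (\<integral>\<^sup>+x. f i x \<partial>lborel))))
          = ennreal (\<Sum>i\<in>UNIV. c * (\<bar>\<beta> i\<bar> * F i / a i))"
        by (simp only: sum_ennreal)
      also have "(\<Sum>i\<in>UNIV. c * (\<bar>\<beta> i\<bar> * F i / a i)) = c * W"
        by (simp only: W_def sum_distrib_left)
      finally show ?thesis
        using K c W by (simp only:) (simp add: ennreal_mult[symmetric] mult_ac)
    qed
    also have "\<dots> \<le> ennreal K * (\<Sum>i\<in>UNIV. ennreal \<bar>\<beta> i\<bar> * (ennreal (1 / a i) * (\<integral>\<^sup>+x. ennreal (\<phi> i x) \<partial>lborel)))"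
      by (intro mult_left_mono sum_mono c\<phi>) auto
    also note le
    also have "ennreal M * (\<Sum>i\<in>UNIV. ennreal (\<bar>\<beta> i\<bar> * F i / a i)) = ennreal (M * W)"
      using F(2) a M W unfolding W_def by (simp add: sum_ennreal ennreal_mult less_imp_le)
    finally have "c * K * W \<le> M * W" using M W by simp
    then show "c * K \<le> M" using W by simp
  qed
  then have "K \<le> M" by (rule field_le_mult_one_interval)
  then show ?thesis unfolding M_def u_def[abs_def] F_def G_def .
next
  case False
  have "0 \<le> power_mean (power_transform 1 p) lam
    (\<lambda>i. lam i / \<bar>\<beta> i\<bar> * (enn2real (\<integral>\<^sup>+x. g i x \<partial>lborel) / enn2real (\<integral>\<^sup>+x. f i x \<partial>lborel)))"
    using is_weightD(2)[OF w] by (intro power_mean_nonneg[OF w]) simp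
  then show ?thesis using False by linarith
qed

section \<open>Integrating out coordinates\<close>

text \<open>The result stays a function on the whole space, for Borel \<open>f\<close> constant
  along the directions integrated out, so the induction on dimension never changes the type.\<close>

primrec partial_integral :: "'a::euclidean_space list \<Rightarrow> ('a \<Rightarrow> ennreal) \<Rightarrow> 'a \<Rightarrow> ennreal" where
  "partial_integral [] f = f"
| "partial_integral (b # bs) f = (\<lambda>x. \<integral>\<^sup>+s. partial_integral bs f (x + s *\<^sub>R b) \<partial>lborel)"

lemma borel_measurable_partial_integral [measurable]:
  assumes "f \<in> borel_measurable borel"
  shows "partial_integral bs f \<in> borel_measurable borel"
proof (induction bs)
  case (Cons b bs)
  note [measurable] = Cons.IH
  show ?case by simp
qed (simp add: assms)

lemma partial_integral_eq_PiM:
  fixes f :: "'a::euclidean_space \<Rightarrow> ennreal"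
  assumes [measurable]: "f \<in> borel_measurable borel" and "distinct bs"
  shows "partial_integral bs f x = (\<integral>\<^sup>+t. f (x + (\<Sum>b\<in>set bs. t b *\<^sub>R b)) \<partial>PiM (set bs) (\<lambda>_. lborel))"
  using assms(2)
proof (induction bs arbitrary: x)
  interpret product_sigma_finite "\<lambda>_::'a. lborel :: real measure" ..
  case Nil
  show ?case by (simp add: PiM_empty)
next
  interpret product_sigma_finite "\<lambda>_::'a. lborel :: real measure" ..
  case (Cons b bs)
  have "(\<integral>\<^sup>+t. f (x + (\<Sum>b\<in>set (b # bs). t b *\<^sub>R b)) \<partial>PiM (set (b # bs)) (\<lambda>_. lborel))
      = (\<integral>\<^sup>+s. (\<integral>\<^sup>+t. f (x + (\<Sum>c\<in>insert b (set bs). (t(b := s)) c *\<^sub>R c)) \<partial>PiM (set bs) (\<lambda>_. lborel)) \<partial>lborel)"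
    using Cons.prems by (simp only: list.set, intro product_nn_integral_insert_rev) auto
  also have "\<dots> = (\<integral>\<^sup>+s. (\<integral>\<^sup>+t. f (x + s *\<^sub>R b + (\<Sum>c\<in>set bs. t c *\<^sub>R c)) \<partial>PiM (set bs) (\<lambda>_. lborel)) \<partial>lborel)"
  proof -
    have "x + (\<Sum>c\<in>insert b (set bs). (t(b := s)) c *\<^sub>R c) = x + s *\<^sub>R b + (\<Sum>c\<in>set bs. t c *\<^sub>R c)" for t s
    proof -
      have "(\<Sum>c\<in>set bs. (t(b := s)) c *\<^sub>R c) = (\<Sum>c\<in>set bs. t c *\<^sub>R c)"
        using Cons.prems by (intro sum.cong) auto
      then show ?thesis using Cons.prems by (simp add: add.assoc)
    qed
    then show ?thesis by (simp only:)
  qed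
  finally show ?case using Cons by simp
qed

lemma partial_integral_Basis:
  fixes f :: "'a::euclidean_space \<Rightarrow> ennreal"
  assumes f[measurable]: "f \<in> borel_measurable borel" and "distinct bs" "set bs = Basis"
  shows "partial_integral bs f x = (\<integral>\<^sup>+y. f y \<partial>lborel)"
proof -
  have "(\<integral>\<^sup>+y. f y \<partial>lborel) = (\<integral>\<^sup>+y. f y \<partial>distr lborel borel ((+) x))"
    by (subst lborel_distr_plus) (rule refl)
  also have "\<dots> = (\<integral>\<^sup>+y. f (x + y) \<partial>lborel)" by (simp add: nn_integral_distr)
  also have "\<dots> = (\<integral>\<^sup>+t. f (x + (\<Sum>b\<in>Basis. t b *\<^sub>R b)) \<partial>PiM Basis (\<lambda>_. lborel))"
    by (subst lborel_eq) (simp add: nn_integral_distr)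
  finally show ?thesis using partial_integral_eq_PiM[OF assms(1,2)] assms(3) by simp
qed

lemma ennreal_mult_less_topD:
  assumes "ennreal c * y < top" "0 < c"
  shows "y < top"
  using assms by (auto simp: ennreal_mult_less_top)

text \<open>\<open>power_transform k\<close> cannot stand for the iterate here: at \<open>k = 0\<close> it is not the identity,
  because \<open>1 / real 0 = 0\<close>.\<close>

lemma partial_integral_inequality:
  fixes lam \<beta> :: "'m::finite \<Rightarrow> real" and f g :: "'m \<Rightarrow> 'a::euclidean_space \<Rightarrow> ennreal"
  assumes w: "is_weight lam" and p: "p \<le> ereal (1 / real n)" and \<beta>: "\<And>i. \<beta> i \<noteq> 0"
    and f[measurable]: "\<And>i. f i \<in> borel_measurable borel" and g[measurable]: "\<And>i. g i \<in> borel_measurable borel"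
    and AE: "AE x in (lborel :: ('a^'m) measure).
      (\<forall>i. 0 < f i (x $ i) \<and> f i (x $ i) < \<infinity> \<and> g i (\<Sum>i\<in>UNIV. \<beta> i *\<^sub>R x $ i) < \<infinity>) \<longrightarrow>
      K \<le> power_mean p lam (\<lambda>i. enn2real (g i (\<Sum>i\<in>UNIV. \<beta> i *\<^sub>R x $ i)) / enn2real (f i (x $ i)))"
    and "length bs \<le> n"
  shows "AE x in (lborel :: ('a^'m) measure).
      (\<forall>i. 0 < partial_integral bs (f i) (x $ i) \<and> partial_integral bs (f i) (x $ i) < \<infinity> \<and>
        partial_integral bs (g i) (\<Sum>i\<in>UNIV. \<beta> i *\<^sub>R x $ i) < \<infinity>) \<longrightarrow>
      K \<le> power_mean ((power_transform 1 ^^ length bs) p) lam (\<lambda>i. (lam i / \<bar>\<beta> i\<bar>) ^ length bs *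
        (enn2real (partial_integral bs (g i) (\<Sum>i\<in>UNIV. \<beta> i *\<^sub>R x $ i)) / enn2real (partial_integral bs (f i) (x $ i))))"
  using assms(7)
proof (induction bs)
  case Nil
  then show ?case using AE by simp
next
  case (Cons b bs)
  define k where "k = length bs"
  define \<omega> where "\<omega> i = lam i / \<bar>\<beta> i\<bar>" for i
  have \<omega>: "0 < \<omega> i" for i using is_weightD(1)[OF w] \<beta> by (simp add: \<omega>_def)
  define q where "q = (power_transform 1 ^^ k) p"
  have q: "q \<le> 1" unfolding q_def using p by (rule power_transform_le_one) (use Cons.prems in \<open>simp add: k_def\<close>)
  \<comment> \<open>All components move along \<open>b\<close> independently, and \<open>z\<close>
    then moves along the same \<open>b\<close> by \<open>\<Sum> \<beta> i * t i\<close>: each fibre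
    is an instance of the one-dimensional problem.\<close>
  define L where "L t = (\<chi> i. t $ i *\<^sub>R b)" for t :: "real^'m"
  have "linear L" unfolding L_def by (rule linearI) (auto simp: vec_eq_iff scaleR_left_distrib)
  then have [measurable]: "L \<in> borel_measurable borel"
    by (intro borel_measurable_continuous_onI linear_continuous_on) (simp add: linear_conv_bounded_linear)
  have IH: "AE x in (lborel :: ('a^'m) measure).
      (\<forall>i. 0 < partial_integral bs (f i) (x $ i) \<and> partial_integral bs (f i) (x $ i) < \<infinity> \<and>
        partial_integral bs (g i) (\<Sum>i\<in>UNIV. \<beta> i *\<^sub>R x $ i) < \<infinity>) \<longrightarrow>
      K \<le> power_mean q lam (\<lambda>i. \<omega> i ^ k *
        (enn2real (partial_integral bs (g i) (\<Sum>i\<in>UNIV. \<beta> i *\<^sub>R x $ i)) / enn2real (partial_integral bs (f i) (x $ i))))"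
    using Cons.IH Cons.prems unfolding k_def q_def \<omega>_def by auto
  have "AE x in (lborel :: ('a^'m) measure). AE t in lborel.
      (\<forall>i. 0 < partial_integral bs (f i) ((x + L t) $ i) \<and> partial_integral bs (f i) ((x + L t) $ i) < \<infinity> \<and>
        partial_integral bs (g i) (\<Sum>i\<in>UNIV. \<beta> i *\<^sub>R (x + L t) $ i) < \<infinity>) \<longrightarrow>
      K \<le> power_mean q lam (\<lambda>i. \<omega> i ^ k *
        (enn2real (partial_integral bs (g i) (\<Sum>i\<in>UNIV. \<beta> i *\<^sub>R (x + L t) $ i)) / enn2real (partial_integral bs (f i) ((x + L t) $ i))))"
    using IH by (rule AE_lborel_fibre) measurable
  then show ?case
  proof eventually_elim
    case (elim x)
    define z where "z = (\<Sum>i\<in>UNIV. \<beta> i *\<^sub>R x $ i)"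
    have zL: "(\<Sum>i\<in>UNIV. \<beta> i *\<^sub>R (x + L t) $ i) = z + (\<Sum>i\<in>UNIV. \<beta> i * t $ i) *\<^sub>R b" for t
      by (simp add: z_def L_def scaleR_right_distrib sum.distrib scaleR_sum_left)
    have xL: "(x + L t) $ i = x $ i + t $ i *\<^sub>R b" for t i by (simp add: L_def)
    define f' where "f' i s = partial_integral bs (f i) (x $ i + s *\<^sub>R b)" for i s
    \<comment> \<open>The factors gathered so far are absorbed into \<open>g'\<close>; the
      one-dimensional inequality contributes one more \<open>\<omega> i\<close>.\<close>
    define g' where "g' i s = ennreal (\<omega> i ^ k) * partial_integral bs (g i) (z + s *\<^sub>R b)" for i s
    have [measurable]: "f' i \<in> borel_measurable borel" "g' i \<in> borel_measurable borel" for i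
      unfolding f'_def g'_def by measurable
    have If: "(\<integral>\<^sup>+s. f' i s \<partial>lborel) = partial_integral (b # bs) (f i) (x $ i)" for i
      by (simp add: f'_def)
    have Ig: "(\<integral>\<^sup>+s. g' i s \<partial>lborel) = ennreal (\<omega> i ^ k) * partial_integral (b # bs) (g i) z" for i
      by (simp add: g'_def nn_integral_cmult)
    have g'_real: "enn2real (g' i s) = \<omega> i ^ k * enn2real (partial_integral bs (g i) (z + s *\<^sub>R b))" for i s
      using \<omega>[of i] by (simp add: g'_def enn2real_mult less_imp_le)
    have g'_fin: "partial_integral bs (g i) (z + s *\<^sub>R b) < \<infinity>" if "g' i s < \<infinity>" for i s
      using that zero_less_power[OF \<omega>[of i], of k] unfolding g'_def infinity_ennreal_def
      by (rule ennreal_mult_less_topD)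
    show ?case
      unfolding z_def[symmetric]
    proof (rule impI)
      assume fin: "\<forall>i. 0 < partial_integral (b # bs) (f i) (x $ i) \<and> partial_integral (b # bs) (f i) (x $ i) < \<infinity> \<and>
        partial_integral (b # bs) (g i) z < \<infinity>"
      have "K \<le> power_mean (power_transform 1 q) lam
        (\<lambda>i. lam i / \<bar>\<beta> i\<bar> * (enn2real (\<integral>\<^sup>+s. g' i s \<partial>lborel) / enn2real (\<integral>\<^sup>+s. f' i s \<partial>lborel)))"
      proof (rule line_inequality[where f = f' and g = g', OF w q \<beta>])
        show "AE t in (lborel :: (real^'m) measure).
          (\<forall>i. 0 < f' i (t $ i) \<and> f' i (t $ i) < \<infinity> \<and> g' i (\<Sum>i\<in>UNIV. \<beta> i * t $ i) < \<infinity>) \<longrightarrow>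
          K \<le> power_mean q lam (\<lambda>i. enn2real (g' i (\<Sum>i\<in>UNIV. \<beta> i * t $ i)) / enn2real (f' i (t $ i)))"
          using elim unfolding zL unfolding xL
        proof eventually_elim
          case (elim t)
          show ?case
          proof
            assume h: "\<forall>i. 0 < f' i (t $ i) \<and> f' i (t $ i) < \<infinity> \<and> g' i (\<Sum>i\<in>UNIV. \<beta> i * t $ i) < \<infinity>"
            have "K \<le> power_mean q lam (\<lambda>i. \<omega> i ^ k *
              (enn2real (partial_integral bs (g i) (z + (\<Sum>i\<in>UNIV. \<beta> i * t $ i) *\<^sub>R b)) /
                enn2real (partial_integral bs (f i) (x $ i + t $ i *\<^sub>R b))))"
            proof (rule mp[OF elim], intro allI conjI)
              fix i
              show "0 < partial_integral bs (f i) (x $ i + t $ i *\<^sub>R b)" "partial_integral bs (f i) (x $ i + t $ i *\<^sub>R b) < \<infinity>"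
                using h by (simp_all add: f'_def)
              show "partial_integral bs (g i) (z + (\<Sum>i\<in>UNIV. \<beta> i * t $ i) *\<^sub>R b) < \<infinity>"
                using h by (intro g'_fin) simp
            qed
            then show "K \<le> power_mean q lam (\<lambda>i. enn2real (g' i (\<Sum>i\<in>UNIV. \<beta> i * t $ i)) / enn2real (f' i (t $ i)))"
              by (simp add: g'_real f'_def)
          qed
        qed
        show "f' i \<in> borel_measurable borel" "g' i \<in> borel_measurable borel" for i by measurable
        show "0 < (\<integral>\<^sup>+s. f' i s \<partial>lborel)" "(\<integral>\<^sup>+s. f' i s \<partial>lborel) < \<infinity>" for i
          unfolding If using fin by blast+
        show "(\<integral>\<^sup>+s. g' i s \<partial>lborel) < \<infinity>" for i
          unfolding Ig using fin by (intro ennreal_mult_less_top[THEN iffD2, folded infinity_ennreal_def]) simp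
      qed
      also have "power_transform 1 q = (power_transform 1 ^^ length (b # bs)) p"
        by (simp add: q_def k_def)
      also have "(\<lambda>i. lam i / \<bar>\<beta> i\<bar> * (enn2real (\<integral>\<^sup>+s. g' i s \<partial>lborel) / enn2real (\<integral>\<^sup>+s. f' i s \<partial>lborel)))
        = (\<lambda>i. (lam i / \<bar>\<beta> i\<bar>) ^ length (b # bs) *
          (enn2real (partial_integral (b # bs) (g i) z) / enn2real (partial_integral (b # bs) (f i) (x $ i))))"
        using \<omega> unfolding If Ig
        by (simp add: fun_eq_iff enn2real_mult less_imp_le k_def \<omega>_def[symmetric] del: partial_integral.simps)
      finally show "K \<le> power_mean ((power_transform 1 ^^ length (b # bs)) p) lam (\<lambda>i. (lam i / \<bar>\<beta> i\<bar>) ^ length (b # bs) *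
          (enn2real (partial_integral (b # bs) (g i) z) / enn2real (partial_integral (b # bs) (f i) (x $ i))))" .
    qed
  qed
qed

text \<open>Once every basis direction is integrated out, the partial integrals are constants,
  positive and finite where required, so a single \<open>x\<close> from the almost-everywhere
  statement suffices.\<close>

lemma euclidean_inequality:
  fixes lam \<beta> :: "'m::finite \<Rightarrow> real" and f g :: "'m \<Rightarrow> 'a::euclidean_space \<Rightarrow> ennreal"
  assumes w: "is_weight lam" and p: "p \<le> ereal (1 / real DIM('a))" and \<beta>: "\<And>i. \<beta> i \<noteq> 0"
    and f[measurable]: "\<And>i. f i \<in> borel_measurable borel" and g[measurable]: "\<And>i. g i \<in> borel_measurable borel"
    and fpos: "\<And>i. 0 < (\<integral>\<^sup>+x. f i x \<partial>lborel)" and ffin: "\<And>i. (\<integral>\<^sup>+x. f i x \<partial>lborel) < \<infinity>"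
    and gfin: "\<And>i. (\<integral>\<^sup>+x. g i x \<partial>lborel) < \<infinity>"
    and AE: "AE x in (lborel :: ('a^'m) measure).
      (\<forall>i. 0 < f i (x $ i) \<and> f i (x $ i) < \<infinity> \<and> g i (\<Sum>i\<in>UNIV. \<beta> i *\<^sub>R x $ i) < \<infinity>) \<longrightarrow>
      K \<le> power_mean p lam (\<lambda>i. enn2real (g i (\<Sum>i\<in>UNIV. \<beta> i *\<^sub>R x $ i)) / enn2real (f i (x $ i)))"
  shows "K \<le> power_mean (power_transform DIM('a) p) lam (\<lambda>i. (lam i / \<bar>\<beta> i\<bar>) ^ DIM('a) *
    (enn2real (\<integral>\<^sup>+x. g i x \<partial>lborel) / enn2real (\<integral>\<^sup>+x. f i x \<partial>lborel)))"
proof -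
  obtain bs :: "'a list" where bs: "distinct bs" "set bs = Basis"
    using finite_distinct_list[OF finite_Basis] by blast
  then have len: "length bs = DIM('a)" using bs distinct_card[of bs] by simp
  note total = partial_integral_Basis[OF _ bs]
  from AE_lborel_exists[OF partial_integral_inequality[OF w p \<beta> f g AE, of bs]] len
  show ?thesis
    using fpos ffin gfin power_transform_funpow[OF p, of "DIM('a)"] by (simp add: total)
qed

text \<open>What remains is to pass from Lebesgue measurable functions to Borel representatives.
  Changing each function on a null set alters the mean only on a null set of tuples, since the
  projections and \<open>z_comb \<beta>\<close> pull null sets back to null sets.\<close>

theorem corollary7p1:
  fixes lam \<beta> :: "'m::finite \<Rightarrow> real"
    and p :: ereal
    and f g :: "'m \<Rightarrow> real^'d \<Rightarrow> real"
  defines "d \<equiv> CARD('d)"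
    and "S \<equiv> {x :: (real^'d)^'m. \<forall>i. x $ i \<in> pos_set (f i)}"
  assumes "is_weight lam"
    and "p \<le> ereal (1 / real d)"
    and "\<And>i. \<beta> i \<noteq> 0"
    and "\<And>i x. 0 \<le> f i x"
    and "\<And>i x. 0 \<le> g i x"
    and "\<And>i. integrable lebesgue (f i)"
    and "\<And>i. integrable lebesgue (g i)"
    and "\<And>i. 0 < L1_norm (f i)"
  shows "ess_inf (restrict_space lebesgue S)
           (\<lambda>x. ereal (power_mean p lam (\<lambda>i. g i (z_comb \<beta> x) / f i (x $ i))))
         \<le> ereal (power_mean (power_transform d p) lam
             (\<lambda>i. (lam i / \<bar>\<beta> i\<bar>) ^ d * (L1_norm (g i) / L1_norm (f i))))"
proof -
  define borel_version where "borel_version h h' \<longleftrightarrow> h' \<in> borel_measurable borel \<and> (AE x in lborel. h x = h' x) \<and>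
      L1_norm h = enn2real (\<integral>\<^sup>+x. ennreal (h' x) \<partial>lborel) \<and> (\<integral>\<^sup>+x. ennreal (h' x) \<partial>lborel) < \<infinity>"
    for h h' :: "real^'d \<Rightarrow> real"
  have rep: "\<exists>h'. borel_version h h'"
    if h: "integrable lebesgue h" "\<And>x. 0 \<le> h x" for h :: "real^'d \<Rightarrow> real"
  proof -
    obtain h' where h': "h' \<in> borel_measurable lborel" "AE x in lborel. h x = h' x"
      using completion_ex_borel_measurable_real borel_measurable_integrable[OF h(1)] by blast
    have eq: "(\<integral>\<^sup>+x. ennreal (h x) \<partial>lebesgue) = (\<integral>\<^sup>+x. ennreal (h' x) \<partial>lborel)"
      unfolding nn_integral_completion using h'(2) by (intro nn_integral_cong_AE) auto
    have "L1_norm h = enn2real (\<integral>\<^sup>+x. ennreal (h x) \<partial>lebesgue)"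
    proof -
      have "L1_norm h = (\<integral>x. h x \<partial>lebesgue)" unfolding L1_norm_def using h(2) by simp
      also have "\<dots> = enn2real (\<integral>\<^sup>+x. ennreal (h x) \<partial>lebesgue)"
        by (rule integral_eq_nn_integral[OF borel_measurable_integrable[OF h(1)]]) (simp add: h(2))
      finally show ?thesis .
    qed
    moreover have "(\<integral>\<^sup>+x. ennreal (h x) \<partial>lebesgue) < \<infinity>"
      using h by (simp add: integrable_iff_bounded)
    ultimately show ?thesis using h' unfolding eq borel_version_def by (intro exI[of _ h']) simp
  qed
  obtain f' where "\<And>i. borel_version (f i) (f' i)"
    using rep[OF assms(8) assms(6)] by metis
  then have f'[measurable]: "\<And>i. f' i \<in> borel_measurable borel"
    and ff': "\<And>i. AE x in lborel. f i x = f' i x"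
    and Lf: "\<And>i. L1_norm (f i) = enn2real (\<integral>\<^sup>+x. ennreal (f' i x) \<partial>lborel)"
    and ffin: "\<And>i. (\<integral>\<^sup>+x. ennreal (f' i x) \<partial>lborel) < \<infinity>"
    by (simp_all add: borel_version_def)
  obtain g' where "\<And>i. borel_version (g i) (g' i)"
    using rep[OF assms(9) assms(7)] by metis
  then have g'[measurable]: "\<And>i. g' i \<in> borel_measurable borel"
    and gg': "\<And>i. AE x in lborel. g i x = g' i x"
    and Lg: "\<And>i. L1_norm (g i) = enn2real (\<integral>\<^sup>+x. ennreal (g' i x) \<partial>lborel)"
    and gfin: "\<And>i. (\<integral>\<^sup>+x. ennreal (g' i x) \<partial>lborel) < \<infinity>"
    by (simp_all add: borel_version_def)
  have fpos: "0 < (\<integral>\<^sup>+x. ennreal (f' i x) \<partial>lborel)" for i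
    using assms(10)[of i] by (simp add: Lf enn2real_positive_iff)
  have L: "linear (\<lambda>y. axis i (c *\<^sub>R y) :: (real^'d)^'m)" for i c
    by (rule linearI) (auto simp: vec_eq_iff axis_def scaleR_right_distrib)
  have Lm: "(\<lambda>y. axis i (c *\<^sub>R y) :: (real^'d)^'m) \<in> borel_measurable borel" for i c
    using L[of i c] by (intro borel_measurable_continuous_onI linear_continuous_on) (simp add: linear_conv_bounded_linear)
  have "AE x in (lborel :: ((real^'d)^'m) measure). f i (x $ i) = f' i (x $ i)" for i
    by (rule AE_lborel_right_inverse[OF Lm[of i 1] _ _ ff']) auto
  then have AEf: "AE x in (lborel :: ((real^'d)^'m) measure). \<forall>i. f i (x $ i) = f' i (x $ i)"
    by (intro AE_all_countable[THEN iffD2] allI)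
  have "AE x in (lborel :: ((real^'d)^'m) measure). g i (z_comb \<beta> x) = g' i (z_comb \<beta> x)" for i
  \<comment> \<open>Placing \<open>y / \<beta> i\<close> in coordinate \<open>i\<close> is a right
    inverse of \<open>z_comb \<beta>\<close>.\<close>
  proof (rule AE_lborel_right_inverse[OF Lm[of i "1 / \<beta> i"] _ _ gg'])
    show "z_comb \<beta> \<in> borel_measurable borel" unfolding z_comb_def[abs_def] by measurable
    fix x :: "(real^'d)^'m" and y :: "real^'d"
    have "(\<Sum>j\<in>UNIV. \<beta> j *\<^sub>R axis i ((1 / \<beta> i) *\<^sub>R y) $ j) = (\<Sum>j\<in>UNIV. if j = i then y else 0)"
      using assms(5) by (intro sum.cong) (auto simp: axis_def)
    then show "z_comb \<beta> (x + axis i ((1 / \<beta> i) *\<^sub>R y)) = z_comb \<beta> x + y"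
      by (simp add: z_comb_def scaleR_right_distrib sum.distrib)
  qed
  then have AEg: "AE x in (lborel :: ((real^'d)^'m) measure). \<forall>i. g i (z_comb \<beta> x) = g' i (z_comb \<beta> x)"
    by (intro AE_all_countable[THEN iffD2] allI)
  \<comment> \<open>\<open>S\<close> agrees almost everywhere with a Borel set. Its measurability
    lets a statement almost everywhere on the restricted space be read as an implication almost
    everywhere.\<close>
  have S: "S \<in> sets lebesgue"
  proof -
    show ?thesis
    proof (rule completion.in_sets_AE)
      have "AE x in lborel. x \<in> {x :: (real^'d)^'m. \<forall>i. 0 < f' i (x $ i)} \<longleftrightarrow> x \<in> S"
        using AEf by eventually_elim (simp add: S_def pos_set_def)
      then show "AE x in lebesgue. x \<in> {x :: (real^'d)^'m. \<forall>i. 0 < f' i (x $ i)} \<longleftrightarrow> x \<in> S"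
        by (rule AE_completion)
      have "{x :: (real^'d)^'m. \<forall>i. 0 < f' i (x $ i)} \<in> sets borel" by measurable
      then show "{x :: (real^'d)^'m. \<forall>i. 0 < f' i (x $ i)} \<in> sets lebesgue" by auto
    qed simp
  qed
  let ?M = "\<lambda>x. power_mean p lam (\<lambda>i. g i (z_comb \<beta> x) / f i (x $ i))"
  let ?R = "power_mean (power_transform d p) lam (\<lambda>i. (lam i / \<bar>\<beta> i\<bar>) ^ d * (L1_norm (g i) / L1_norm (f i)))"
  show ?thesis
    unfolding ess_inf_def
  proof (rule Sup_least, rule ccontr)
    fix c assume "c \<in> {c. AE x in restrict_space lebesgue S. c \<le> ereal (?M x)}" and "\<not> c \<le> ereal ?R"
    then have "AE x in restrict_space lebesgue S. c \<le> ereal (?M x)" and "ereal ?R < c" by auto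
    then have AEc: "AE x in lborel. x \<in> S \<longrightarrow> c \<le> ereal (?M x)"
      using S by (simp add: AE_restrict_space_iff AE_completion_iff)
    \<comment> \<open>The lower bound \<open>c\<close> may be infinite, so a real number strictly
      between is used.\<close>
    obtain K where K: "?R < K" "ereal K < c"
      using ereal_dense2[OF \<open>ereal ?R < c\<close>] by auto
    have "K \<le> power_mean (power_transform DIM(real^'d) p) lam (\<lambda>i. (lam i / \<bar>\<beta> i\<bar>) ^ DIM(real^'d) *
      (enn2real (\<integral>\<^sup>+x. ennreal (g' i x) \<partial>lborel) / enn2real (\<integral>\<^sup>+x. ennreal (f' i x) \<partial>lborel)))"
    proof (rule euclidean_inequality[OF assms(3) _ assms(5) _ _ fpos ffin gfin])
      show "p \<le> ereal (1 / real DIM(real^'d))" using assms(4) by (simp add: d_def)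
      show "AE x in (lborel :: ((real^'d)^'m) measure).
        (\<forall>i. 0 < ennreal (f' i (x $ i)) \<and> ennreal (f' i (x $ i)) < \<infinity> \<and>
          ennreal (g' i (\<Sum>i\<in>UNIV. \<beta> i *\<^sub>R x $ i)) < \<infinity>) \<longrightarrow>
        K \<le> power_mean p lam (\<lambda>i. enn2real (ennreal (g' i (\<Sum>i\<in>UNIV. \<beta> i *\<^sub>R x $ i))) / enn2real (ennreal (f' i (x $ i))))"
        using AEc AEf AEg
      proof eventually_elim
        case (elim x)
        show ?case
        proof
          assume "\<forall>i. 0 < ennreal (f' i (x $ i)) \<and> ennreal (f' i (x $ i)) < \<infinity> \<and>
            ennreal (g' i (\<Sum>i\<in>UNIV. \<beta> i *\<^sub>R x $ i)) < \<infinity>"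
          then have "x \<in> S" using elim(2) by (simp add: S_def pos_set_def)
          then have "ereal K \<le> ereal (?M x)" using elim(1) K(2) by (meson less_imp_le order_trans)
          moreover have "enn2real (ennreal (g' i (\<Sum>i\<in>UNIV. \<beta> i *\<^sub>R x $ i))) = g i (z_comb \<beta> x)" for i
            using elim(3) assms(7)[of i "z_comb \<beta> x"] by (simp add: z_comb_def)
          moreover have "enn2real (ennreal (f' i (x $ i))) = f i (x $ i)" for i
            using elim(2) assms(6)[of i "x $ i"] by simp
          ultimately show "K \<le> power_mean p lam (\<lambda>i. enn2real (ennreal (g' i (\<Sum>i\<in>UNIV. \<beta> i *\<^sub>R x $ i))) / enn2real (ennreal (f' i (x $ i))))"
            by simp
        qed
      qed
    qed measurable
    then show False using K(1) by (simp add: d_def Lf Lg)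
  qed
qed

end
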